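(* Let $(\mathbb C^n,G)$ be a complex Minkowski space. Let $(N,H)$ be a strongly pseudoconvex complex Finsler manifold whose holomorphic sectional curvature is bounded from above by a negative constant $K_2$. Then any holomorphic mapping $f$ from $\mathbb C^n$ into $N$ is constant.
   Context: A complex Minkowski space is $\mathbb C^n$ with the complex Finsler metric $G(p;v)=\|v\|^2$ for all $p\in\mathbb C^n$, $v\in T^{1,0}_p\mathbb C^n\cong\mathbb C^n$, where $\|\cdot\|$ is a complex norm on $\mathbb C^n$ with strongly convex unit ball (so that $\|\cdot\|^2$ is smooth with positive definite real Hessian on $\mathbb C^n\setminus\{0\}$). For a complex manifold $N$ with holomorphic coordinates $z^\alpha$ and $\tilde N=T^{1,0}N\setminus\{\text{zero section}\}$ with coordinates $(z;v)$, a complex Finsler metric is a continuous $H:T^{1,0}N\to[0,\infty)$, smooth on $\tilde N$, with $H(z;v)=0$ iff $v=0$ and $H(z;\zeta v)=|\zeta|^2H(z;v)$ for $\zeta\in\mathbb C$. It is strongly pseudoconvex if $(H_{\alpha\bar\beta})=\big(\frac{\partial^2H}{\partial v^\alpha\partial\bar v^\beta}\big)$ is positive definite on $\tilde N$. With subscripts denoting $v$-derivatives and subscripts after a semicolon $z$-derivatives, set $\Gamma^\beta_{;\alpha}=H^{\beta\bar\gamma}H_{\bar\gamma;\alpha}$, $\delta_\alpha=\frac{\partial}{\partial z^\alpha}-\Gamma^\beta_{;\alpha}\frac{\partial}{\partial v^\beta}$, $\delta_{\bar\nu}=\overline{\delta_\nu}$. The holomorphic sectional curvature along $v\in\tilde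 N$ is $K_H(v)=\frac{2}{H(v)^2}\langle\Omega(\chi,\bar\chi)\chi,\chi\rangle_v$, where $\chi=v^\alpha\delta_\alpha$ and $\Omega$ is the curvature of the Chern-Finsler connection; explicitly $K_H(v)=-\frac{2}{H(v)^2}H_\alpha\,\delta_{\bar\nu}(\Gamma^\alpha_{;\mu})\,v^\mu\bar v^\nu$. *)

theory Defs
  imports "HOL-Analysis.Analysis"
begin

section \<open>Smooth and holomorphic maps between Euclidean spaces\<close>

primrec C_k_on :: "nat \<Rightarrow> ('a::real_normed_vector \<Rightarrow> 'b::real_normed_vector) \<Rightarrow> 'a set \<Rightarrow> bool" where
  "C_k_on 0 f S \<longleftrightarrow> continuous_on S f"
| "C_k_on (Suc k) f S \<longleftrightarrow>
     (\<forall>x\<in>S. f differentiable (at x)) \<and> (\<forall>w. C_k_on k (\<lambda>x. frechet_derivative f (at x) w) S)"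

text \<open>Intended for open \<open>S\<close> in a finite-dimensional space, where this is the usual
  \<open>C\<close>-infinity over the reals.\<close>

definition smooth_on :: "'a set \<Rightarrow> ('a::real_normed_vector \<Rightarrow> 'b::real_normed_vector) \<Rightarrow> bool" where
  "smooth_on S f \<longleftrightarrow> (\<forall>k. C_k_on k f S)"

text \<open>Intended for open \<open>S\<close>: differentiability at every point with complex linear differential.\<close>

definition hol_on :: "(complex^'n \<Rightarrow> complex^'m) \<Rightarrow> (complex^'n) set \<Rightarrow> bool" where
  "hol_on f S \<longleftrightarrow>
     (\<forall>x\<in>S. \<exists>D. (f has_derivative D) (at x) \<and> (\<forall>c v. D (c *s v) = c *s D v))"


section \<open>Complex Minkowski spaces\<close>

definition complex_norm :: "(complex^'n \<Rightarrow> real) \<Rightarrow> bool" where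
  "complex_norm N \<longleftrightarrow>
     (\<forall>v. 0 \<le> N v \<and> (N v = 0 \<longleftrightarrow> v = 0)) \<and>
     (\<forall>c v. N (c *s v) = cmod c * N v) \<and>
     (\<forall>v w. N (v + w) \<le> N v + N w)"

text \<open>The unit ball is strongly convex: the square of the norm is smooth off the origin, with
  positive definite real Hessian.\<close>

definition strongly_convex_norm :: "(complex^'n \<Rightarrow> real) \<Rightarrow> bool" where
  "strongly_convex_norm N \<longleftrightarrow>
     smooth_on (- {0}) (\<lambda>v. (N v)\<^sup>2) \<and>
     (\<forall>v w. v \<noteq> 0 \<longrightarrow> w \<noteq> 0 \<longrightarrow>
        0 < frechet_derivative (\<lambda>x. frechet_derivative (\<lambda>v. (N v)\<^sup>2) (at x) w) (at v) w)"

definition complex_minkowski :: "(complex^'n \<Rightarrow> complex^'n \<Rightarrow> real) \<Rightarrow> bool" where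
  "complex_minkowski G \<longleftrightarrow>
     (\<exists>N. complex_norm N \<and> strongly_convex_norm N \<and> (\<forall>p v. G p v = (N v)\<^sup>2))"


section \<open>Complex manifolds\<close>

text \<open>A chart is a pair of its domain and its coordinate map; only the values of the coordinate map
  on the domain matter.\<close>

type_synonym ('a, 'm) chart = "'a set \<times> ('a \<Rightarrow> complex^'m)"

definition chart_inv :: "('a, 'm::finite) chart \<Rightarrow> complex^'m \<Rightarrow> 'a" where
  "chart_inv c = inv_into (fst c) (snd c)"

definition chart_image :: "('a, 'm::finite) chart \<Rightarrow> (complex^'m) set" where
  "chart_image c = snd c ` fst c"

definition transition :: "('a, 'm::finite) chart \<Rightarrow> ('a, 'm) chart \<Rightarrow> complex^'m \<Rightarrow> complex^'m" where
  "transition c d = snd d \<circ> chart_inv c"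

locale complex_manifold =
  fixes X :: "'a topology" and A :: "('a, 'm::finite) chart set"
  assumes Hausdorff: "Hausdorff_space X"
    and second_countable: "second_countable X"
    and chart_domain: "c \<in> A \<Longrightarrow> openin X (fst c)"
    and open_chart_image: "c \<in> A \<Longrightarrow> open (chart_image c)"
    and chart_homeomorphic: "c \<in> A \<Longrightarrow>
          homeomorphic_map (subtopology X (fst c)) (top_of_set (chart_image c)) (snd c)"
    and charts_cover: "topspace X = (\<Union>c\<in>A. fst c)"
    and charts_compatible: "c \<in> A \<Longrightarrow> d \<in> A \<Longrightarrow>
          hol_on (transition c d) (snd c ` (fst c \<inter> fst d))"

definition hol_map_into :: "'a topology \<Rightarrow> ('a, 'm::finite) chart set \<Rightarrow> (complex^'n \<Rightarrow> 'a) \<Rightarrow> bool" where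
  "hol_map_into X A f \<longleftrightarrow>
     continuous_map euclidean X f \<and> (\<forall>c\<in>A. hol_on (snd c \<circ> f) (f -` fst c))"


section \<open>The holomorphic tangent bundle\<close>

definition charts_at :: "('a, 'm::finite) chart set \<Rightarrow> 'a \<Rightarrow> ('a, 'm) chart set" where
  "charts_at A p = {c \<in> A. p \<in> fst c}"

text \<open>A vector of type \<open>(1,0)\<close> at \<open>p\<close> is a family of coordinate vectors, one for each chart
  around \<open>p\<close>, which transforms by the differentials of the coordinate changes.  Charts not
  containing \<open>p\<close> get the dummy value \<open>0\<close>, so that the zero vector is \<open>\<lambda>_. 0\<close>.\<close>

type_synonym ('a, 'm) tvec = "('a, 'm) chart \<Rightarrow> complex^'m"

definition hol_tangent :: "('a, 'm::finite) chart set \<Rightarrow> 'a \<Rightarrow> ('a, 'm) tvec set" where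
  "hol_tangent A p = {V.
     (\<forall>c. c \<notin> charts_at A p \<longrightarrow> V c = 0) \<and>
     (\<forall>c\<in>charts_at A p. \<forall>d\<in>charts_at A p.
        V d = frechet_derivative (transition c d) (at (snd c p)) (V c))}"

type_synonym 'm tcoords = "(complex^'m) \<times> (complex^'m)"

text \<open>The tangent vector with base point \<open>z\<close> and components \<open>v\<close> in the coordinates of \<open>c\<close>.\<close>

definition tvec_of_coords :: "('a, 'm::finite) chart set \<Rightarrow> ('a, 'm) chart \<Rightarrow> complex^'m \<Rightarrow> complex^'m \<Rightarrow> ('a, 'm) tvec" where
  "tvec_of_coords A c z v =
     (\<lambda>d. if d \<in> charts_at A (chart_inv c z) then frechet_derivative (transition c d) (at z) v else 0)"

definition in_coords :: "('a, 'm::finite) chart set \<Rightarrow> ('a \<Rightarrow> ('a, 'm) tvec \<Rightarrow> real) \<Rightarrow>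
    ('a, 'm) chart \<Rightarrow> 'm tcoords \<Rightarrow> real" where
  "in_coords A H c = (\<lambda>(z, v). H (chart_inv c z) (tvec_of_coords A c z v))"


section \<open>Complex Finsler metrics\<close>

definition complex_finsler :: "'a topology \<Rightarrow> ('a, 'm::finite) chart set \<Rightarrow> ('a \<Rightarrow> ('a, 'm) tvec \<Rightarrow> real) \<Rightarrow> bool" where
  "complex_finsler X A H \<longleftrightarrow>
     (\<forall>p\<in>topspace X. \<forall>V\<in>hol_tangent A p.
        0 \<le> H p V \<and> (H p V = 0 \<longleftrightarrow> V = (\<lambda>_. 0)) \<and>
        (\<forall>\<zeta>. H p (\<lambda>c. \<zeta> *s V c) = (cmod \<zeta>)\<^sup>2 * H p V)) \<and>
     (\<forall>c\<in>A. continuous_on (chart_image c \<times> UNIV) (in_coords A H c) \<and>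
             smooth_on (chart_image c \<times> (- {0})) (in_coords A H c))"

text \<open>Wirtinger derivatives in the coordinates \<open>(z, v)\<close> on the tangent bundle.\<close>

definition d_z :: "'m \<Rightarrow> ('m tcoords \<Rightarrow> complex) \<Rightarrow> ('m::finite) tcoords \<Rightarrow> complex" where
  "d_z \<alpha> F x = (frechet_derivative F (at x) (axis \<alpha> 1, 0)
               - \<i> * frechet_derivative F (at x) (axis \<alpha> \<i>, 0)) / 2"

definition d_zbar :: "'m \<Rightarrow> ('m tcoords \<Rightarrow> complex) \<Rightarrow> ('m::finite) tcoords \<Rightarrow> complex" where
  "d_zbar \<alpha> F x = (frechet_derivative F (at x) (axis \<alpha> 1, 0)
                  + \<i> * frechet_derivative F (at x) (axis \<alpha> \<i>, 0)) / 2"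

definition d_v :: "'m \<Rightarrow> ('m tcoords \<Rightarrow> complex) \<Rightarrow> ('m::finite) tcoords \<Rightarrow> complex" where
  "d_v \<alpha> F x = (frechet_derivative F (at x) (0, axis \<alpha> 1)
               - \<i> * frechet_derivative F (at x) (0, axis \<alpha> \<i>)) / 2"

definition d_vbar :: "'m \<Rightarrow> ('m tcoords \<Rightarrow> complex) \<Rightarrow> ('m::finite) tcoords \<Rightarrow> complex" where
  "d_vbar \<alpha> F x = (frechet_derivative F (at x) (0, axis \<alpha> 1)
                  + \<i> * frechet_derivative F (at x) (0, axis \<alpha> \<i>)) / 2"

text \<open>In the following definitions \<open>L\<close> is the metric in local coordinates, and
  \<open>levi L x $ \<alpha> $ \<beta>\<close> is \<open>H\<^sub>\<alpha>\<^sub>\<beta>\<close> with the index \<open>\<beta>\<close> barred.\<close>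

definition levi :: "('m tcoords \<Rightarrow> real) \<Rightarrow> ('m::finite) tcoords \<Rightarrow> complex^'m^'m" where
  "levi L x = (\<chi> \<alpha> \<beta>. d_v \<alpha> (d_vbar \<beta> (\<lambda>y. complex_of_real (L y))) x)"

definition hermitian_pos_def :: "complex^'m::finite^'m \<Rightarrow> bool" where
  "hermitian_pos_def M \<longleftrightarrow>
     (\<forall>\<alpha> \<beta>. M $ \<alpha> $ \<beta> = cnj (M $ \<beta> $ \<alpha>)) \<and>
     (\<forall>w. w \<noteq> 0 \<longrightarrow> 0 < Re (\<Sum>\<alpha>\<in>UNIV. \<Sum>\<beta>\<in>UNIV. M $ \<alpha> $ \<beta> * w $ \<alpha> * cnj (w $ \<beta>)))"

definition strongly_pseudoconvex :: "('a, 'm::finite) chart set \<Rightarrow> ('a \<Rightarrow> ('a, 'm) tvec \<Rightarrow> real) \<Rightarrow> bool" where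
  "strongly_pseudoconvex A H \<longleftrightarrow>
     (\<forall>c\<in>A. \<forall>z\<in>chart_image c. \<forall>v. v \<noteq> 0 \<longrightarrow> hermitian_pos_def (levi (in_coords A H c) (z, v)))"

text \<open>\<open>\<Gamma>\<close> with upper index \<open>\<beta>\<close> and lower index \<open>;\<alpha>\<close>.  The inverse metric with upper
  indices \<open>\<beta>\<close> and barred \<open>\<gamma>\<close> is characterised by
  \<open>(\<Sum>\<gamma>. H\<^sup>\<beta>\<^sup>\<gamma> * H\<^sub>\<alpha>\<^sub>\<gamma>) = (if \<alpha> = \<beta> then 1 else 0)\<close>, so it is the entry \<open>(\<gamma>, \<beta>)\<close>
  (barred index first) of the matrix inverse.\<close>

definition chern_finsler_coeff ::
    "('m tcoords \<Rightarrow> real) \<Rightarrow> 'm \<Rightarrow> 'm \<Rightarrow> ('m::finite) tcoords \<Rightarrow> complex" where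
  "chern_finsler_coeff L \<beta> \<alpha> x =
     (\<Sum>\<gamma>\<in>UNIV. matrix_inv (levi L x) $ \<gamma> $ \<beta> * d_z \<alpha> (d_vbar \<gamma> (\<lambda>y. complex_of_real (L y))) x)"

text \<open>The conjugate of
  \<open>\<delta>\<^sub>\<nu> = \<partial>/\<partial>z\<^sup>\<nu> - (\<Sum>\<beta>. \<Gamma>\<^sup>\<beta>\<^sub>;\<^sub>\<nu> \<partial>/\<partial>v\<^sup>\<beta>)\<close>.\<close>

definition delta_bar ::
    "('m tcoords \<Rightarrow> real) \<Rightarrow> 'm \<Rightarrow> ('m tcoords \<Rightarrow> complex) \<Rightarrow>
     ('m::finite) tcoords \<Rightarrow> complex" where
  "delta_bar L \<nu> F x =
     d_zbar \<nu> F x - (\<Sum>\<beta>\<in>UNIV. cnj (chern_finsler_coeff L \<beta> \<nu> x) * d_vbar \<beta> F x)"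

text \<open>The coordinate expression of \<open>2 / H\<^sup>2 * \<langle>\<Omega>(\<chi>, cnj \<chi>) \<chi>, \<chi>\<rangle>\<close>, where \<open>\<Omega>\<close> is the curvature
  of the Chern-Finsler connection and \<open>\<chi>\<close> is the horizontal lift of \<open>v\<close>.  It is real by the
  symmetries of \<open>\<Omega>\<close>; \<open>Re\<close> only changes the type.\<close>

definition hsc_coords :: "('m tcoords \<Rightarrow> real) \<Rightarrow> ('m::finite) tcoords \<Rightarrow> real" where
  "hsc_coords L x =
     - 2 / (L x)\<^sup>2 *
     Re (\<Sum>\<alpha>\<in>UNIV. \<Sum>\<mu>\<in>UNIV. \<Sum>\<nu>\<in>UNIV.
           d_v \<alpha> (\<lambda>y. complex_of_real (L y)) x * delta_bar L \<nu> (chern_finsler_coeff L \<alpha> \<mu>) x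
           * snd x $ \<mu> * cnj (snd x $ \<nu>))"

text \<open>The holomorphic sectional curvature along the tangent vector \<open>V\<close> at \<open>p\<close>, computed in the
  chart \<open>c\<close> around \<open>p\<close>; its value does not depend on \<open>c\<close>.\<close>

definition hol_sect_curv :: "('a, 'm::finite) chart set \<Rightarrow> ('a \<Rightarrow> ('a, 'm) tvec \<Rightarrow> real) \<Rightarrow>
    ('a, 'm) chart \<Rightarrow> 'a \<Rightarrow> ('a, 'm) tvec \<Rightarrow> real" where
  "hol_sect_curv A H c p V = hsc_coords (in_coords A H c) (snd c p, V c)"

definition hol_sect_curv_le :: "'a topology \<Rightarrow> ('a, 'm::finite) chart set \<Rightarrow> ('a \<Rightarrow> ('a, 'm) tvec \<Rightarrow> real) \<Rightarrow>
    real \<Rightarrow> bool" where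
  "hol_sect_curv_le X A H K \<longleftrightarrow>
     (\<forall>p\<in>topspace X. \<forall>V\<in>hol_tangent A p. V \<noteq> (\<lambda>_. 0) \<longrightarrow>
        (\<forall>c\<in>charts_at A p. hol_sect_curv A H c p V \<le> K))"

end

theory Submission
  imports Defs "HOL-Complex_Analysis.Cauchy_Integral_Formula"
begin

text \<open>
  It suffices to show that \<open>f\<close> is constant along every complex line.  For a holomorphic curve \<open>g\<close> in
  \<open>N\<close> put \<open>u(\<zeta>) = H(g(\<zeta>); g'(\<zeta>))\<close>.  Split the velocity of the lifted curve \<open>(g, g')\<close> in the tangent
  bundle into its horizontal part \<open>\<chi>\<close>, at which \<open>H\<close> is stationary, and a vertical part.  The Levi form of \<open>H\<close>
  is block diagonal for this splitting; on \<open>\<chi>\<close> it equals \<open>- K\<^sub>H H\<^sup>2 / 2\<close>, and on the vertical part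
  it dominates the gradient term by Cauchy-Schwarz.  Hence \<open>\<Delta> log u \<ge> - 2 K\<^sub>2 u\<close> wherever \<open>u > 0\<close>, and
  comparison with the Poincare metric of discs of radius \<open>R \<rightarrow> \<infinity>\<close> (Ahlfors) forces \<open>u = 0\<close>.
\<close>

text \<open>The obstacle is that \<open>H\<close> is assumed smooth only off the zero section, so
  \<open>u\<close> is only known to be continuous where the curve has velocity zero. The comparison
  survives because it uses the differential inequality only at a maximum of
  \<open>u * \<rho>\<^sup>2\<close> with
  \<open>\<rho> = R\<^sup>2 - \<bar>\<zeta> - p\<bar>\<^sup>2\<close>, and there \<open>u\<close> is
  positive as soon as \<open>u p\<close> is. The curvature is never handled as a tensor. Homogeneity
  makes the (1,0) derivative of \<open>H\<close> in any direction its Levi product with the radial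
  vertical vector, and the Chern-Finsler coefficients are those that make horizontal lifts
  Levi-orthogonal to vertical vectors. Stationarity along \<chi>, the curvature formula and the
  Cauchy-Schwarz estimate thus become statements about a single Hermitian form. Constants: the
  Laplacian is 4 times the mixed Wirtinger derivative, and 4 times \<open>- K\<^sub>2 / 2\<close> is
  \<open>- 2 * K\<^sub>2\<close>. The logarithm of the inverse square of \<open>\<rho>\<close> has
  Laplacian \<open>8 * R\<^sup>2 / \<rho>\<^sup>2\<close>, whence the bound
  \<open>8 / (\<kappa> * R\<^sup>2)\<close> for \<open>u p\<close>, which tends to 0.\<close>

section \<open>Symmetry of second derivatives\<close>

lemma smooth_on_imp_differentiable:
  "smooth_on S f \<Longrightarrow> x \<in> S \<Longrightarrow> f differentiable (at x)"
  unfolding smooth_on_def by (metis C_k_on.simps(2))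

lemma smooth_on_imp_continuous_on: "smooth_on S f \<Longrightarrow> continuous_on S f"
  unfolding smooth_on_def by (metis C_k_on.simps(1))

lemma smooth_on_frechet_derivative:
  "smooth_on S f \<Longrightarrow> smooth_on S (\<lambda>x. frechet_derivative f (at x) w)"
  unfolding smooth_on_def by (metis C_k_on.simps(2))

text \<open>The mean value theorem is applied in direction \<open>a\<close> to the difference of
  \<open>f\<close> between the two edges parallel to \<open>a\<close>, and again in direction
  \<open>b\<close> to the derivative so obtained. The left side is symmetric in \<open>a\<close> and
  \<open>b\<close>, which the next lemma exploits.\<close>

lemma second_difference_mvt:
  fixes f :: "'a::real_normed_vector \<Rightarrow> real"
  assumes h: "0 < h"
    and f: "\<And>s t. 0 \<le> s \<Longrightarrow> s \<le> h \<Longrightarrow> 0 \<le> t \<Longrightarrow> t \<le> h \<Longrightarrow> (f has_derivative f' (x + s *\<^sub>R a + t *\<^sub>R b)) (at (x + s *\<^sub>R a + t *\<^sub>R b))"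
    and f': "\<And>s t. 0 \<le> s \<Longrightarrow> s \<le> h \<Longrightarrow> 0 \<le> t \<Longrightarrow> t \<le> h \<Longrightarrow> ((\<lambda>y. f' y a) has_derivative f'' (x + s *\<^sub>R a + t *\<^sub>R b)) (at (x + s *\<^sub>R a + t *\<^sub>R b))"
  obtains s t where "0 < s" "s < h" "0 < t" "t < h"
    "f (x + h *\<^sub>R a + h *\<^sub>R b) - f (x + h *\<^sub>R a) - f (x + h *\<^sub>R b) + f x = h\<^sup>2 * f'' (x + s *\<^sub>R a + t *\<^sub>R b) b"
proof -
  have 1: "((\<lambda>s. f (x + s *\<^sub>R a + h *\<^sub>R b) - f (x + s *\<^sub>R a)) has_real_derivative
      f' (x + s *\<^sub>R a + h *\<^sub>R b) a - f' (x + s *\<^sub>R a) a) (at s)" if s: "0 \<le> s" "s \<le> h" for s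
  proof -
    have A: "((\<lambda>s. x + s *\<^sub>R a + c *\<^sub>R b) has_derivative (\<lambda>r. r *\<^sub>R a)) (at s)" for c
      by (auto intro!: derivative_eq_intros)
    have *: "((\<lambda>s. f (x + s *\<^sub>R a + c *\<^sub>R b)) has_derivative (\<lambda>r. r * f' (x + s *\<^sub>R a + c *\<^sub>R b) a)) (at s)"
      if "0 \<le> c" "c \<le> h" for c
    proof -
      have "((\<lambda>s. f (x + s *\<^sub>R a + c *\<^sub>R b)) has_derivative (\<lambda>r. f' (x + s *\<^sub>R a + c *\<^sub>R b) (r *\<^sub>R a))) (at s)"
        using has_derivative_compose [OF A f] s that by blast
      moreover have "linear (f' (x + s *\<^sub>R a + c *\<^sub>R b))"
        using f [OF s that] has_derivative_linear by blast
      ultimately show ?thesis by (simp add: linear_scale)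
    qed
    show ?thesis
      unfolding has_field_derivative_def
      by (rule has_derivative_eq_rhs [OF has_derivative_diff [OF *[of h] *[of 0, simplified]]])
         (use h in \<open>auto simp: fun_eq_iff algebra_simps\<close>)
  qed
  obtain s where s: "0 < s" "s < h" and seq: "(f (x + h *\<^sub>R a + h *\<^sub>R b) - f (x + h *\<^sub>R a)) - (f (x + 0 *\<^sub>R a + h *\<^sub>R b) - f (x + 0 *\<^sub>R a))
      = (h - 0) * (f' (x + s *\<^sub>R a + h *\<^sub>R b) a - f' (x + s *\<^sub>R a) a)"
    using MVT2 [OF h 1] by blast
  have 2: "((\<lambda>t. f' (x + s *\<^sub>R a + t *\<^sub>R b) a) has_real_derivative f'' (x + s *\<^sub>R a + t *\<^sub>R b) b) (at t)"
    if t: "0 \<le> t" "t \<le> h" for t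
  proof -
    have A: "((\<lambda>t. x + s *\<^sub>R a + t *\<^sub>R b) has_derivative (\<lambda>r. r *\<^sub>R b)) (at t)"
      by (auto intro!: derivative_eq_intros)
    have "((\<lambda>t. f' (x + s *\<^sub>R a + t *\<^sub>R b) a) has_derivative (\<lambda>r. f'' (x + s *\<^sub>R a + t *\<^sub>R b) (r *\<^sub>R b))) (at t)"
      using has_derivative_compose [OF A f'] s that by auto
    moreover have "linear (f'' (x + s *\<^sub>R a + t *\<^sub>R b))"
      using f' [OF _ _ t, of s] s has_derivative_linear by force
    ultimately show ?thesis
      unfolding has_field_derivative_def by (simp add: linear_scale mult_commute_abs)
  qed
  obtain t where t: "0 < t" "t < h" and teq: "f' (x + s *\<^sub>R a + h *\<^sub>R b) a - f' (x + s *\<^sub>R a + 0 *\<^sub>R b) a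
      = (h - 0) * f'' (x + s *\<^sub>R a + t *\<^sub>R b) b"
    using MVT2 [OF h 2] by blast
  show thesis
    by (rule that [OF s t]) (use seq teq in \<open>simp add: power2_eq_square algebra_simps\<close>)
qed

text \<open>The same second difference, read in either order of the directions, is
  \<open>h\<^sup>2\<close> times one or the other mixed derivative at points near \<open>x\<close>;
  continuity excludes different values at \<open>x\<close>. Only directional derivatives occur,
  matching the form of \<open>C_k_on\<close>.\<close>

lemma second_derivative_symmetric:
  fixes f :: "'a::real_normed_vector \<Rightarrow> real"
  assumes S: "open S" "x \<in> S"
    and f: "\<And>y. y \<in> S \<Longrightarrow> (f has_derivative f' y) (at y)"
    and fa: "\<And>y. y \<in> S \<Longrightarrow> ((\<lambda>y. f' y a) has_derivative fa y) (at y)"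
    and fb: "\<And>y. y \<in> S \<Longrightarrow> ((\<lambda>y. f' y b) has_derivative fb y) (at y)"
    and ca: "continuous_on S (\<lambda>y. fa y b)" and cb: "continuous_on S (\<lambda>y. fb y a)"
  shows "fa x b = fb x a"
proof (rule ccontr)
  assume ne: "fa x b \<noteq> fb x a"
  define e where "e = dist (fa x b) (fb x a) / 2"
  have e: "e > 0" using ne by (simp add: e_def)
  have "isCont (\<lambda>y. fa y b) x" "isCont (\<lambda>y. fb y a) x"
    using ca cb S continuous_on_eq_continuous_at by blast+
  then obtain d1 d2 where d1: "d1 > 0" "\<And>y. dist y x < d1 \<Longrightarrow> dist (fa y b) (fa x b) < e"
    and d2: "d2 > 0" "\<And>y. dist y x < d2 \<Longrightarrow> dist (fb y a) (fb x a) < e"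
    using e unfolding continuous_at_eps_delta by metis
  obtain d3 where d3: "d3 > 0" "\<And>y. dist y x < d3 \<Longrightarrow> y \<in> S"
    using S unfolding open_dist by blast
  define d where "d = min d1 (min d2 d3)"
  have d: "d > 0" using d1 d2 d3 by (simp add: d_def)
  \<comment> \<open>This size keeps the whole parallelogram within distance \<open>d / 2\<close> of
    \<open>x\<close>; the summand 1 covers \<open>a = b = 0\<close>.\<close>
  define h where "h = d / (2 * (norm a + norm b + 1))"
  have nz: "norm a + norm b + 1 > 0" by (smt (verit) norm_ge_zero)
  have h: "h > 0" using d nz by (simp add: h_def)
  have near: "dist (x + s *\<^sub>R a + t *\<^sub>R b) x < d" if "0 \<le> s" "s \<le> h" "0 \<le> t" "t \<le> h" for s t
  proof -
    have "dist (x + s *\<^sub>R a + t *\<^sub>R b) x = norm (s *\<^sub>R a + t *\<^sub>R b)"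
      by (simp add: dist_norm add.assoc)
    also have "\<dots> \<le> s * norm a + t * norm b"
      using norm_triangle_ineq [of "s *\<^sub>R a" "t *\<^sub>R b"] that by simp
    also have "\<dots> \<le> h * norm a + h * norm b"
      using that by (intro add_mono mult_right_mono) auto
    also have "\<dots> \<le> h * (norm a + norm b + 1)"
      using h by (simp add: algebra_simps)
    also have "\<dots> = d / 2"
      unfolding h_def using nz by (metis less_irrefl times_divide_eq_left divide_divide_eq_left nonzero_mult_div_cancel_right)
    also have "\<dots> < d" using d by simp
    finally show ?thesis .
  qed
  have inS: "x + s *\<^sub>R a + t *\<^sub>R b \<in> S" "x + t *\<^sub>R b + s *\<^sub>R a \<in> S" if "0 \<le> s" "s \<le> h" "0 \<le> t" "t \<le> h" for s t
    using near [OF that] d3 by (auto simp: d_def add_ac)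
  obtain s t where st: "0 < s" "s < h" "0 < t" "t < h"
    "f (x + h *\<^sub>R a + h *\<^sub>R b) - f (x + h *\<^sub>R a) - f (x + h *\<^sub>R b) + f x = h\<^sup>2 * fa (x + s *\<^sub>R a + t *\<^sub>R b) b"
    by (rule second_difference_mvt [OF h, of f f' x a b fa]) (use f fa inS in auto)
  obtain t' s' where st': "0 < t'" "t' < h" "0 < s'" "s' < h"
    "f (x + h *\<^sub>R b + h *\<^sub>R a) - f (x + h *\<^sub>R b) - f (x + h *\<^sub>R a) + f x = h\<^sup>2 * fb (x + t' *\<^sub>R b + s' *\<^sub>R a) a"
    by (rule second_difference_mvt [OF h, of f f' x b a fb]) (use f fb inS in auto)
  have e1: "x + h *\<^sub>R b + h *\<^sub>R a = x + h *\<^sub>R a + h *\<^sub>R b"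
    and e2: "x + t' *\<^sub>R b + s' *\<^sub>R a = x + s' *\<^sub>R a + t' *\<^sub>R b"
    by simp_all
  have "h\<^sup>2 * fa (x + s *\<^sub>R a + t *\<^sub>R b) b = h\<^sup>2 * fb (x + s' *\<^sub>R a + t' *\<^sub>R b) a"
    using st(5) st'(5) unfolding e1 e2 by linarith
  then have "fa (x + s *\<^sub>R a + t *\<^sub>R b) b = fb (x + s' *\<^sub>R a + t' *\<^sub>R b) a" using h by simp
  moreover have "dist (fa (x + s *\<^sub>R a + t *\<^sub>R b) b) (fa x b) < e" "dist (fb (x + s' *\<^sub>R a + t' *\<^sub>R b) a) (fb x a) < e"
    using near [of s t] near [of s' t'] st st' d1 d2 by (auto simp: d_def)
  ultimately show False unfolding e_def dist_real_def by (smt (verit) field_sum_of_halves)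
qed

section \<open>The Ahlfors-Schwarz lemma\<close>

text \<open>A positive \<open>c\<close> would make \<open>h'\<close> positive just to the right of
  its zero at 0, and the mean value theorem would then lift \<open>h\<close> above
  \<open>h 0\<close>.\<close>

lemma second_derivative_nonpos_at_local_max:
  fixes h :: "real \<Rightarrow> real"
  assumes d: "d > 0"
    and h: "\<And>t. \<bar>t\<bar> < d \<Longrightarrow> (h has_real_derivative h' t) (at t)"
    and h': "(h' has_real_derivative c) (at 0)"
    and max: "\<And>t. \<bar>t\<bar> < d \<Longrightarrow> h t \<le> h 0"
  shows "c \<le> 0"
proof (rule ccontr)
  assume "\<not> c \<le> 0"
  then obtain e where e: "e > 0" "\<And>s. 0 < s \<Longrightarrow> s < e \<Longrightarrow> h' 0 < h' s"
    using DERIV_pos_inc_right [OF h'] by auto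
  have h0: "h' 0 = 0"
    by (rule DERIV_local_max [OF h d]) (use d max in auto)
  define r where "r = min d e / 2"
  have r: "0 < r" "r < d" "r < e" using d e by (auto simp: r_def)
  obtain s where s: "0 < s" "s < r" "h r - h 0 = (r - 0) * h' s"
    using MVT2 [OF r(1), of h h'] h r by force
  have "0 < h' s" using e(2) [of s] s r h0 by simp
  then have "0 < h r - h 0" using s r by simp
  then show False using max [of r] r by simp
qed

text \<open>This is \<open>\<Delta> (ln u) \<ge> \<kappa> * u\<close> at \<open>\<zeta>\<close>, multiplied by \<open>u\<^sup>2\<close>.\<close>

definition log_laplacian_ge :: "real \<Rightarrow> (complex \<Rightarrow> real) \<Rightarrow> complex \<Rightarrow> bool" where
  "log_laplacian_ge \<kappa> u \<zeta> \<longleftrightarrow> (\<exists>d u' u''. d > 0 \<and>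
     (\<forall>e\<in>{1, \<i>}. \<forall>t. \<bar>t\<bar> < d \<longrightarrow> 0 < u (\<zeta> + of_real t * e) \<and>
        ((\<lambda>t. u (\<zeta> + of_real t * e)) has_real_derivative u' e t) (at t)) \<and>
     (\<forall>e\<in>{1, \<i>}. (u' e has_real_derivative u'' e) (at 0)) \<and>
     \<kappa> * u \<zeta> ^ 3 \<le> u \<zeta> * (u'' 1 + u'' \<i>) - (u' 1 0)\<^sup>2 - (u' \<i> 0)\<^sup>2)"

text \<open>This is the comparison along one real line through the maximum point, with
  \<open>D - 2 * b * t - t\<^sup>2\<close> in the role of
  \<open>R\<^sup>2 - \<bar>\<zeta> - p\<bar>\<^sup>2\<close>. The right side is minus the second
  derivative at 0 of twice the logarithm of that quadratic.\<close>

lemma log_second_derivative_at_max: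
  fixes w :: "real \<Rightarrow> real"
  assumes d: "d > 0" and D: "D > 0"
    and w: "\<And>t. \<bar>t\<bar> < d \<Longrightarrow> 0 < w t \<and> (w has_real_derivative w' t) (at t)"
    and w': "(w' has_real_derivative w'') (at 0)"
    and pos: "\<And>t. \<bar>t\<bar> < d \<Longrightarrow> 0 < D - 2 * b * t - t\<^sup>2"
    and max: "\<And>t. \<bar>t\<bar> < d \<Longrightarrow> w t * (D - 2 * b * t - t\<^sup>2)\<^sup>2 \<le> w 0 * D\<^sup>2"
  shows "(w 0 * w'' - (w' 0)\<^sup>2) / (w 0)\<^sup>2 \<le> 4 / D + 8 * b\<^sup>2 / D\<^sup>2"
proof -
  define h where "h t = ln (w t) + 2 * ln (D - 2 * b * t - t\<^sup>2)" for t
  have 1: "(h has_real_derivative w' t / w t - 4 * (b + t) / (D - 2 * b * t - t\<^sup>2)) (at t)"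
    if "\<bar>t\<bar> < d" for t
    unfolding h_def using w [OF that] pos [OF that]
    by (auto intro!: derivative_eq_intros simp: field_simps)
  have 2: "((\<lambda>t. w' t / w t - 4 * (b + t) / (D - 2 * b * t - t\<^sup>2)) has_real_derivative
      (w 0 * w'' - (w' 0)\<^sup>2) / (w 0)\<^sup>2 - (4 / D + 8 * b\<^sup>2 / D\<^sup>2)) (at 0)"
  proof -
    have a: "((\<lambda>t. w' t / w t) has_real_derivative (w 0 * w'' - (w' 0)\<^sup>2) / (w 0)\<^sup>2) (at 0)"
      by (rule derivative_eq_intros w' refl conjunct2 [OF w] | use w [of 0] d in force)+
         (use w [of 0] d in \<open>simp add: power2_eq_square mult.commute\<close>)
    have b: "((\<lambda>t. 4 * (b + t) / (D - 2 * b * t - t\<^sup>2)) has_real_derivative (4 / D + 8 * b\<^sup>2 / D\<^sup>2)) (at 0)"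
      using D by (auto intro!: derivative_eq_intros simp: power2_eq_square divide_simps)
    show ?thesis by (rule DERIV_diff [OF a b])
  qed
  have 3: "h t \<le> h 0" if t: "\<bar>t\<bar> < d" for t
  proof -
    have q: "0 < D - 2 * b * t - t\<^sup>2" "0 < w t" "0 < w 0" using pos t w d by auto
    have "h t = ln (w t * (D - 2 * b * t - t\<^sup>2)\<^sup>2)"
      using q by (simp add: h_def ln_mult ln_realpow)
    also have "\<dots> \<le> ln (w 0 * D\<^sup>2)"
      using max [OF t] q D by (subst ln_le_cancel_iff) auto
    also have "\<dots> = h 0" using q D by (simp add: h_def ln_mult ln_realpow)
    finally show ?thesis .
  qed
  show ?thesis
    using second_derivative_nonpos_at_local_max [OF d 1 2 3] by simp
qed

lemma norm_add_of_real_mult_squared: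
  assumes "cmod e = 1"
  shows "(cmod (z + of_real t * e))\<^sup>2 = (cmod z)\<^sup>2 + 2 * Re (z * cnj e) * t + t\<^sup>2"
proof -
  have "(cmod (z + of_real t * e))\<^sup>2 = (cmod z)\<^sup>2 + 2 * Re (z * cnj e) * t + t\<^sup>2 * (cmod e)\<^sup>2"
    unfolding cmod_power2 by (simp add: algebra_simps power2_eq_square)
  then show ?thesis by (simp add: assms)
qed

text \<open>Comparison with the Poincare metric of a disc: \<open>u * (R\<^sup>2 - \<bar>\<zeta> - p\<bar>\<^sup>2)\<^sup>2\<close> attains its maximum over
  the disc at an interior point, where the Laplacian of its logarithm is nonpositive.\<close>

lemma Ahlfors_Schwarz_disc:
  fixes u :: "complex \<Rightarrow> real"
  assumes cont: "continuous_on UNIV u" and nonneg: "\<And>\<zeta>. 0 \<le> u \<zeta>"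
    and \<kappa>: "\<kappa> > 0" and R: "R > 0"
    and lap: "\<And>\<zeta>. 0 < u \<zeta> \<Longrightarrow> log_laplacian_ge \<kappa> u \<zeta>"
  shows "u p * R\<^sup>2 \<le> 8 / \<kappa>"
proof (cases "u p = 0")
  case True
  then show ?thesis using \<kappa> by simp
next
  case False
  then have up: "0 < u p" using nonneg [of p] by simp
  define \<rho> where "\<rho> \<zeta> = R\<^sup>2 - (cmod (\<zeta> - p))\<^sup>2" for \<zeta>
  have "continuous_on (cball p R) (\<lambda>\<zeta>. u \<zeta> * (\<rho> \<zeta>)\<^sup>2)"
    unfolding \<rho>_def by (intro continuous_intros continuous_on_subset [OF cont]) auto
  then obtain q where q: "q \<in> cball p R" "\<And>\<zeta>. \<zeta> \<in> cball p R \<Longrightarrow> u \<zeta> * (\<rho> \<zeta>)\<^sup>2 \<le> u q * (\<rho> q)\<^sup>2"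
    using continuous_attains_sup [of "cball p R" "\<lambda>\<zeta>. u \<zeta> * (\<rho> \<zeta>)\<^sup>2"] R by auto
  \<comment> \<open>The value at the centre serves twice: it gives \<open>u q > 0\<close>, so that
    the differential inequality is available at \<open>q\<close>, and it carries the final bound
    back to \<open>p\<close>.\<close>
  have pq: "u p * (R\<^sup>2)\<^sup>2 \<le> u q * (\<rho> q)\<^sup>2" using q(2) [of p] R by (simp add: \<rho>_def)
  moreover have "0 < u p * (R\<^sup>2)\<^sup>2" using up R by simp
  ultimately have "u q * (\<rho> q)\<^sup>2 > 0" by linarith
  then have uq: "0 < u q" and rq0: "\<rho> q \<noteq> 0" using nonneg [of q] by (auto simp: zero_less_mult_iff)
  have "cmod (q - p) \<le> R" using q(1) by (simp add: dist_norm norm_minus_commute)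
  then have "0 \<le> \<rho> q" unfolding \<rho>_def using power_mono [of "cmod (q - p)" R 2] by simp
  then have rq: "0 < \<rho> q" using rq0 by simp
  obtain d u' u'' where d: "d > 0"
    and u: "\<And>e t. e \<in> {1, \<i>} \<Longrightarrow> \<bar>t\<bar> < d \<Longrightarrow> 0 < u (q + of_real t * e) \<and>
        ((\<lambda>t. u (q + of_real t * e)) has_real_derivative u' e t) (at t)"
    and u': "\<And>e. e \<in> {1, \<i>} \<Longrightarrow> (u' e has_real_derivative u'' e) (at 0)"
    and ineq: "\<kappa> * u q ^ 3 \<le> u q * (u'' 1 + u'' \<i>) - (u' 1 0)\<^sup>2 - (u' \<i> 0)\<^sup>2"
    using lap [OF uq] unfolding log_laplacian_ge_def by blast
  \<comment> \<open>While \<open>\<rho>\<close> stays positive the points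
    \<open>q + of_real t * e\<close> remain in the disc, so \<open>q\<close> is a maximum along both
    coordinate directions.\<close>
  have "isCont \<rho> q" unfolding \<rho>_def by (intro continuous_intros)
  then obtain d' where d': "d' > 0" "\<And>\<zeta>. dist \<zeta> q < d' \<Longrightarrow> dist (\<rho> \<zeta>) (\<rho> q) < \<rho> q"
    using rq unfolding continuous_at_eps_delta by blast
  have dir: "(u q * u'' e - (u' e 0)\<^sup>2) / (u q)\<^sup>2 \<le> 4 / \<rho> q + 8 * (Re ((q - p) * cnj e))\<^sup>2 / (\<rho> q)\<^sup>2"
    if e: "e \<in> {1, \<i>}" for e
  proof -
    have ne: "cmod e = 1" using e by auto
    define b where "b = Re ((q - p) * cnj e)"
    have "(cmod (q - p + of_real t * e))\<^sup>2 = (cmod (q - p))\<^sup>2 + 2 * b * t + t\<^sup>2" for t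
      unfolding b_def by (rule norm_add_of_real_mult_squared [OF ne])
    then have rho: "\<rho> (q + of_real t * e) = \<rho> q - 2 * b * t - t\<^sup>2" for t
      by (simp add: \<rho>_def algebra_simps)
    have rpos: "0 < \<rho> (q + of_real t * e)" if "\<bar>t\<bar> < d'" for t
    proof -
      have "dist (q + of_real t * e) q < d'" using that ne by (simp add: dist_norm norm_mult)
      from d'(2) [OF this] show ?thesis unfolding dist_real_def by linarith
    qed
    have max: "u (q + of_real t * e) * (\<rho> (q + of_real t * e))\<^sup>2 \<le> u q * (\<rho> q)\<^sup>2" if "\<bar>t\<bar> < d'" for t
    proof (rule q(2))
      have "(cmod (q + of_real t * e - p))\<^sup>2 < R\<^sup>2" using rpos [OF that] by (simp add: \<rho>_def)
      then have "cmod (q + of_real t * e - p) < R" using R power2_less_imp_less by fastforce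
      then show "q + of_real t * e \<in> cball p R" by (simp add: dist_norm norm_minus_commute)
    qed
    have "(u (q + of_real 0 * e) * u'' e - (u' e 0)\<^sup>2) / (u (q + of_real 0 * e))\<^sup>2
        \<le> 4 / \<rho> q + 8 * b\<^sup>2 / (\<rho> q)\<^sup>2"
      by (rule log_second_derivative_at_max [where w = "\<lambda>t. u (q + of_real t * e)" and d = "min d d'" and w' = "u' e"])
         (use d d' rq u [OF e] u' [OF e] rpos max in \<open>auto simp flip: rho\<close>)
    then show ?thesis by (simp add: b_def)
  qed
  have "\<kappa> * u q = \<kappa> * u q ^ 3 / (u q)\<^sup>2"
    using uq by (simp add: power3_eq_cube power2_eq_square)
  also have "\<dots> \<le> (u q * (u'' 1 + u'' \<i>) - (u' 1 0)\<^sup>2 - (u' \<i> 0)\<^sup>2) / (u q)\<^sup>2"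
    using ineq by (intro divide_right_mono) auto
  also have "\<dots> = (u q * u'' 1 - (u' 1 0)\<^sup>2) / (u q)\<^sup>2 + (u q * u'' \<i> - (u' \<i> 0)\<^sup>2) / (u q)\<^sup>2"
    by (simp add: add_divide_distrib diff_divide_distrib algebra_simps)
  \<comment> \<open>Each direction contributes \<open>4 / \<rho> q\<close>, and the squared
    components of \<open>q - p\<close> along 1 and \<open>\<i>\<close> add up to its squared
    modulus.\<close>
  also have "\<dots> \<le> 8 / \<rho> q + 8 * (cmod (q - p))\<^sup>2 / (\<rho> q)\<^sup>2"
    using dir [of 1] dir [of \<i>] by (simp add: cmod_power2 add_divide_distrib algebra_simps)
  also have "\<dots> = 8 * R\<^sup>2 / (\<rho> q)\<^sup>2"
  proof -
    have "R\<^sup>2 = \<rho> q + (cmod (q - p))\<^sup>2" by (simp add: \<rho>_def)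
    then show ?thesis using rq by (simp add: field_simps power2_eq_square)
  qed
  finally have "\<kappa> * (u q * (\<rho> q)\<^sup>2) \<le> 8 * R\<^sup>2"
    using rq by (simp add: field_simps)
  then have "\<kappa> * (u p * (R\<^sup>2)\<^sup>2) \<le> 8 * R\<^sup>2"
    using mult_left_mono [OF pq, of \<kappa>] \<kappa> by linarith
  then have "(\<kappa> * (u p * R\<^sup>2)) * R\<^sup>2 \<le> 8 * R\<^sup>2" by (simp add: power2_eq_square algebra_simps)
  then have "\<kappa> * (u p * R\<^sup>2) \<le> 8" using R by simp
  then show ?thesis using \<kappa> by (simp add: field_simps)
qed

lemma Ahlfors_Schwarz_plane:
  fixes u :: "complex \<Rightarrow> real"
  assumes "continuous_on UNIV u" "\<And>\<zeta>. 0 \<le> u \<zeta>" "\<kappa> > 0"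
    and "\<And>\<zeta>. 0 < u \<zeta> \<Longrightarrow> log_laplacian_ge \<kappa> u \<zeta>"
  shows "u p = 0"
proof (rule ccontr)
  assume "u p \<noteq> 0"
  then have up: "0 < u p" using assms(2) [of p] by simp
  \<comment> \<open>This choice makes \<open>u p * R\<^sup>2\<close> equal to
    \<open>8 / \<kappa> + u p\<close>, just above the bound for discs.\<close>
  define R where "R = sqrt (8 / \<kappa> / u p + 1)"
  have "8 / \<kappa> / u p + 1 > 0" using up assms(3) by (simp add: add_nonneg_pos)
  then have R: "R > 0" "R\<^sup>2 = 8 / \<kappa> / u p + 1" by (simp_all add: R_def)
  then have "u p * R\<^sup>2 = 8 / \<kappa> + u p" using up by (simp add: field_simps)
  then show False
    using Ahlfors_Schwarz_disc [of u \<kappa> R p] assms R up by simp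
qed

section \<open>Wirtinger derivatives in arbitrary directions\<close>

text \<open>\<open>cscale \<i>\<close> is the complex structure on the real vector space of pairs
  \<open>(z, v)\<close>; the types (1,0) and (0,1) are expressed through it.\<close>

definition cscale :: "complex \<Rightarrow> 'm tcoords \<Rightarrow> ('m::finite) tcoords" where
  "cscale c a = (c *s fst a, c *s snd a)"

lemma cscale_simps [simp]:
  "fst (cscale c a) = c *s fst a" "snd (cscale c a) = c *s snd a"
  "cscale c (h, k) = (c *s h, c *s k)"
  by (simp_all add: cscale_def)

lemma cscale_cscale: "cscale c (cscale d a) = cscale (c * d) a"
  by (simp add: cscale_def vector_smult_assoc)

lemma scaleR_conv_smult: "r *\<^sub>R (v::complex^'m) = complex_of_real r *s v"
  by (simp add: vec_eq_iff complex_eq_iff)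

lemma cscale_conv_scaleR: "cscale c a = Re c *\<^sub>R a + Im c *\<^sub>R cscale \<i> a"
  by (simp add: prod_eq_iff vec_eq_iff complex_eq_iff)

lemma linear_cscale: "linear (cscale c)"
  by (rule linearI) (simp_all add: prod_eq_iff vec_eq_iff algebra_simps)

definition wd :: "'m tcoords \<Rightarrow> ('m tcoords \<Rightarrow> complex) \<Rightarrow> ('m::finite) tcoords \<Rightarrow> complex" where
  "wd a F x = (frechet_derivative F (at x) a - \<i> * frechet_derivative F (at x) (cscale \<i> a)) / 2"

definition wdb :: "'m tcoords \<Rightarrow> ('m tcoords \<Rightarrow> complex) \<Rightarrow> ('m::finite) tcoords \<Rightarrow> complex" where
  "wdb a F x = (frechet_derivative F (at x) a + \<i> * frechet_derivative F (at x) (cscale \<i> a)) / 2"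

lemma smult_axis_one [simp]: "c *s axis \<alpha> (1::complex) = axis \<alpha> c"
  by (simp add: vec_eq_iff axis_def)

lemma d_wd:
  "d_z \<alpha> = wd (axis \<alpha> 1, 0)" "d_zbar \<alpha> = wdb (axis \<alpha> 1, 0)"
  "d_v \<alpha> = wd (0, axis \<alpha> 1)" "d_vbar \<alpha> = wdb (0, axis \<alpha> 1)"
  by (simp_all add: fun_eq_iff d_z_def d_zbar_def d_v_def d_vbar_def wd_def wdb_def)

lemma wd_eqI: "(F has_derivative F') (at x) \<Longrightarrow> wd a F x = (F' a - \<i> * F' (cscale \<i> a)) / 2"
  unfolding wd_def by (metis frechet_derivative_at)

lemma wdb_eqI: "(F has_derivative F') (at x) \<Longrightarrow> wdb a F x = (F' a + \<i> * F' (cscale \<i> a)) / 2"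
  unfolding wdb_def by (metis frechet_derivative_at)

lemma wd_cong:
  assumes "open S" "x \<in> S" "\<And>y. y \<in> S \<Longrightarrow> F y = F' y" "F' differentiable (at x)"
  shows "wd a F x = wd a F' x"
  using assms frechet_derivative_transform_within_open [of F' x S F]
  unfolding wd_def by (metis (no_types, lifting))

lemma wdb_cong:
  assumes "open S" "x \<in> S" "\<And>y. y \<in> S \<Longrightarrow> F y = F' y" "F' differentiable (at x)"
  shows "wdb a F x = wdb a F' x"
  using assms frechet_derivative_transform_within_open [of F' x S F]
  unfolding wdb_def by (metis (no_types, lifting))

lemma wdb_add:
  assumes "F differentiable (at x)"
  shows "wdb (a + b) F x = wdb a F x + wdb b F x"
proof -
  have "linear (frechet_derivative F (at x))"
    using assms linear_frechet_derivative by blast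
  then show ?thesis
    by (simp add: wdb_def linear_add linear_add [OF linear_cscale] algebra_simps add_divide_distrib)
qed

lemma wdb_cscale:
  assumes "F differentiable (at x)"
  shows "wdb (cscale c a) F x = cnj c * wdb a F x"
proof -
  have l: "linear (frechet_derivative F (at x))"
    using assms linear_frechet_derivative by blast
  define A where "A = frechet_derivative F (at x) a"
  define B where "B = frechet_derivative F (at x) (cscale \<i> a)"
  have 1: "frechet_derivative F (at x) (cscale d a) = Re d *\<^sub>R A + Im d *\<^sub>R B" for d
    by (subst cscale_conv_scaleR) (simp add: linear_add [OF l] linear_scale [OF l] A_def B_def)
  show ?thesis unfolding wdb_def
    by (simp add: cscale_cscale 1) (simp add: A_def [symmetric] B_def [symmetric] complex_eq_iff algebra_simps)
qed

section \<open>Complex velocities of vector-valued holomorphic curves\<close>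

lemma has_derivative_vec:
  fixes F :: "'a::real_normed_vector \<Rightarrow> 'b::euclidean_space^'m"
  assumes "\<And>i. ((\<lambda>x. F x $ i) has_derivative (\<lambda>h. F' h $ i)) (at a within T)"
  shows "(F has_derivative F') (at a within T)"
  unfolding has_derivative_componentwise_within [of F] Basis_vec_def
  using assms by (auto simp: inner_axis intro!: has_derivative_inner_left)

definition vderiv :: "(complex \<Rightarrow> complex^'m) \<Rightarrow> complex \<Rightarrow> complex^'m" where
  "vderiv F \<zeta> = (\<chi> i. deriv (\<lambda>s. F s $ i) \<zeta>)"

lemma vderiv_has_derivative:
  assumes "\<And>i. (\<lambda>s. F s $ i) holomorphic_on W" "open W" "\<zeta> \<in> W"
  shows "(F has_derivative (\<lambda>h. h *s vderiv F \<zeta>)) (at \<zeta>)"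
proof (rule has_derivative_vec)
  fix i
  have "((\<lambda>s. F s $ i) has_field_derivative deriv (\<lambda>s. F s $ i) \<zeta>) (at \<zeta>)"
    by (rule holomorphic_derivI [OF assms])
  then show "((\<lambda>s. F s $ i) has_derivative (\<lambda>h. (h *s vderiv F \<zeta>) $ i)) (at \<zeta>)"
    by (simp add: has_field_derivative_def vderiv_def mult_commute_abs)
qed

lemma vderiv_holomorphic:
  assumes "\<And>i. (\<lambda>s. F s $ i) holomorphic_on W" "open W"
  shows "(\<lambda>s. vderiv F s $ i) holomorphic_on W"
  unfolding vderiv_def using holomorphic_deriv [OF assms(1) assms(2), of i] by (simp add: eta_contract_eq)

lemma vderiv_unique:
  assumes "(F has_derivative (\<lambda>h. h *s w)) (at \<zeta>)"
  shows "vderiv F \<zeta> = w"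
proof -
  have "((\<lambda>s. F s $ i) has_derivative (\<lambda>h. (h *s w) $ i)) (at \<zeta>)" for i
    using assms bounded_linear.has_derivative bounded_linear_vec_nth by blast
  then have "((\<lambda>s. F s $ i) has_field_derivative w $ i) (at \<zeta>)" for i
    by (simp add: has_field_derivative_def mult_commute_abs)
  then show ?thesis by (simp add: vderiv_def vec_eq_iff DERIV_imp_deriv)
qed

lemma has_derivative_cscale_line:
  assumes "(F has_derivative (\<lambda>h. cscale h a)) (at (\<zeta> + of_real t * e))"
  shows "((\<lambda>t. F (\<zeta> + of_real t * e)) has_derivative (\<lambda>r. r *\<^sub>R cscale e a)) (at (t::real))"
proof -
  have "((\<lambda>t. \<zeta> + of_real t * e) has_derivative (\<lambda>r. of_real r * e)) (at t)"
    by (auto intro!: derivative_eq_intros)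
  from has_derivative_compose [OF this assms] show ?thesis
    by (simp add: cscale_def scaleR_conv_smult vector_smult_assoc)
qed

text \<open>Together with Cramer's rule this yields differentiability of the Chern-Finsler
  coefficients, which are defined through an inverse matrix.\<close>

lemma det_differentiable:
  fixes M :: "'a::real_normed_vector \<Rightarrow> 'b::real_normed_field^'n^'n"
  assumes "\<And>i j. (\<lambda>y. M y $ i $ j) differentiable (at x)"
  shows "(\<lambda>y. det (M y)) differentiable (at x)"
proof -
  have "(\<lambda>y. \<Prod>i\<in>I. M y $ i $ p i) differentiable (at x)" for p and I :: "'n set"
    using assms by (induction I rule: infinite_finite_induct) auto
  then show ?thesis unfolding det_def by auto
qed

lemma matrix_inv_inverse:
  fixes M :: "'a::field^'n^'n"
  assumes "invertible M"
  shows "M ** matrix_inv M = mat 1" "matrix_inv M ** M = mat 1"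
  using someI_ex [OF assms [unfolded invertible_def]] unfolding matrix_inv_def by auto

section \<open>The Levi form of a Finsler metric in coordinates\<close>

text \<open>The metric in a single chart, with all calculus confined to the complement of the zero
  section. The manifold arguments use it one chart at a time.\<close>

locale finsler_coords =
  fixes L :: "('m::finite) tcoords \<Rightarrow> real" and U :: "(complex^'m) set"
  assumes open_U: "open U"
    and smooth: "smooth_on (U \<times> - {0}) L"
    and homogeneous: "z \<in> U \<Longrightarrow> L (z, c *s v) = (cmod c)\<^sup>2 * L (z, v)"
    and pseudoconvex: "z \<in> U \<Longrightarrow> v \<noteq> 0 \<Longrightarrow> hermitian_pos_def (levi L (z, v))"
begin

definition S :: "'m tcoords set" where "S = U \<times> - {0}"

text \<open>Iterated directional derivatives follow the recursion of \<open>C_k_on\<close>, so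
  \<open>D1\<close> and \<open>D2\<close> inherit smoothness at once.\<close>

definition D1 :: "'m tcoords \<Rightarrow> 'm tcoords \<Rightarrow> real" where
  "D1 a x = frechet_derivative L (at x) a"

definition D2 :: "'m tcoords \<Rightarrow> 'm tcoords \<Rightarrow> 'm tcoords \<Rightarrow> real" where
  "D2 a b x = frechet_derivative (D1 a) (at x) b"

lemma open_S: "open S"
  unfolding S_def using open_U by (intro open_Times) auto

lemma smooth_L: "smooth_on S L"
  using smooth by (simp add: S_def)

lemma smooth_D1: "smooth_on S (D1 a)"
  unfolding D1_def by (rule smooth_on_frechet_derivative [OF smooth_L])

lemma smooth_D2: "smooth_on S (D2 a b)"
  unfolding D2_def by (rule smooth_on_frechet_derivative [OF smooth_D1])

lemma L_has_derivative: "x \<in> S \<Longrightarrow> (L has_derivative (\<lambda>a. D1 a x)) (at x)"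
  unfolding D1_def by (metis smooth_on_imp_differentiable smooth_L frechet_derivative_works)

lemma D1_has_derivative: "x \<in> S \<Longrightarrow> (D1 a has_derivative (\<lambda>b. D2 a b x)) (at x)"
  unfolding D2_def by (metis smooth_on_imp_differentiable smooth_D1 frechet_derivative_works)

lemma linear_D1: "x \<in> S \<Longrightarrow> linear (\<lambda>a. D1 a x)"
  using L_has_derivative has_derivative_linear by blast

lemma linear_D2: "x \<in> S \<Longrightarrow> linear (\<lambda>b. D2 a b x)"
  using D1_has_derivative has_derivative_linear by blast

lemma D2_commute:
  assumes "x \<in> S"
  shows "D2 a b x = D2 b a x"
  by (rule second_derivative_symmetric [OF open_S assms L_has_derivative D1_has_derivative D1_has_derivative
        smooth_on_imp_continuous_on [OF smooth_D2] smooth_on_imp_continuous_on [OF smooth_D2]])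

lemma linear_D2_left: "x \<in> S \<Longrightarrow> linear (\<lambda>a. D2 a b x)"
  by (subst D2_commute, assumption) (rule linear_D2)

text \<open>\<open>P a\<close> is the derivative of \<open>L\<close> in the \<open>(1,0)\<close> direction \<open>a\<close>, and \<open>B a b\<close> its Levi form on the
  whole tangent bundle: the conjugate \<open>b\<close>-derivative of \<open>P a\<close>.\<close>

definition P :: "'m tcoords \<Rightarrow> 'm tcoords \<Rightarrow> complex" where
  "P a x = (complex_of_real (D1 a x) - \<i> * D1 (cscale \<i> a) x) / 2"

definition B :: "'m tcoords \<Rightarrow> 'm tcoords \<Rightarrow> 'm tcoords \<Rightarrow> complex" where
  "B a b x = (complex_of_real (D2 a b x + D2 (cscale \<i> a) (cscale \<i> b) x)
            + \<i> * (D2 a (cscale \<i> b) x - D2 (cscale \<i> a) b x)) / 4"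

lemma cscale_ii [simp]: "cscale \<i> (cscale \<i> a) = - a"
  by (simp add: cscale_def prod_eq_iff vec_eq_iff)

lemma P_add: "x \<in> S \<Longrightarrow> P (a + b) x = P a x + P b x"
  by (simp add: P_def linear_add [OF linear_cscale] linear_add [OF linear_D1] complex_eq_iff add_divide_distrib diff_divide_distrib)

text \<open>Writing \<open>cscale c a\<close> as a real combination of \<open>a\<close> and
  \<open>cscale \<i> a\<close> reduces complex linearity to real linearity of \<open>D1\<close> and
  the square -1 of the complex structure. \<open>B_cscale_left\<close> is obtained in the same
  way.\<close>

lemma P_cscale:
  assumes "x \<in> S"
  shows "P (cscale c a) x = c * P a x"
proof -
  have "P (Re c *\<^sub>R a + Im c *\<^sub>R cscale \<i> a) x = c * P a x"
    unfolding P_def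
    by (simp only: linear_add [OF linear_cscale] linear_scale [OF linear_cscale] cscale_ii
        linear_add [OF linear_D1 [OF assms]] linear_scale [OF linear_D1 [OF assms]] linear_neg [OF linear_D1 [OF assms]])
       (simp add: complex_eq_iff add_divide_distrib diff_divide_distrib algebra_simps)
  then show ?thesis by (metis cscale_conv_scaleR)
qed

lemma B_add_left: "x \<in> S \<Longrightarrow> B (a + a') b x = B a b x + B a' b x"
  by (simp add: B_def linear_add [OF linear_cscale] linear_add [OF linear_D2_left] complex_eq_iff add_divide_distrib diff_divide_distrib)

lemma B_cscale_left:
  assumes "x \<in> S"
  shows "B (cscale c a) b x = c * B a b x"
proof -
  have "B (Re c *\<^sub>R a + Im c *\<^sub>R cscale \<i> a) b x = c * B a b x"
    unfolding B_def
    by (simp only: linear_add [OF linear_cscale] linear_scale [OF linear_cscale] cscale_ii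
        linear_add [OF linear_D2_left [OF assms]] linear_scale [OF linear_D2_left [OF assms]] linear_neg [OF linear_D2_left [OF assms]])
       (simp add: complex_eq_iff add_divide_distrib diff_divide_distrib algebra_simps)
  then show ?thesis by (metis cscale_conv_scaleR)
qed

text \<open>Hermitian symmetry comes from the symmetry of \<open>D2\<close>; it turns each rule for
  the left argument into a conjugate rule for the right one.\<close>

lemma B_cnj: "x \<in> S \<Longrightarrow> cnj (B a b x) = B b a x"
  by (simp add: B_def D2_commute [of x b] D2_commute [of x "cscale \<i> b"] complex_eq_iff)

lemma B_add_right: "x \<in> S \<Longrightarrow> B a (b + b') x = B a b x + B a b' x"
  by (metis B_add_left B_cnj complex_cnj_add)

lemma B_cscale_right: "x \<in> S \<Longrightarrow> B a (cscale c b) x = cnj c * B a b x"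
  by (metis B_cscale_left B_cnj complex_cnj_mult)

lemma P_zero: "x \<in> S \<Longrightarrow> P 0 x = 0"
  using P_add [of x 0 0] by simp

lemma B_zero_left: "x \<in> S \<Longrightarrow> B 0 b x = 0"
  using B_add_left [of x 0 0] by simp

lemma P_sum: "x \<in> S \<Longrightarrow> P (\<Sum>i\<in>I. a i) x = (\<Sum>i\<in>I. P (a i) x)"
  by (induction I rule: infinite_finite_induct) (simp_all add: P_add P_zero)

lemma B_sum_left: "x \<in> S \<Longrightarrow> B (\<Sum>i\<in>I. a i) b x = (\<Sum>i\<in>I. B (a i) b x)"
  by (induction I rule: infinite_finite_induct) (simp_all add: B_add_left B_zero_left)

section \<open>Expansion in coordinate directions\<close>

lemma horizontal_basis: "(h, 0) = (\<Sum>\<alpha>\<in>UNIV. cscale (h $ \<alpha>) (axis \<alpha> 1, 0 :: complex^'m))"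
  by (simp add: prod_eq_iff fst_sum snd_sum vec_eq_iff axis_def if_distrib cong: if_cong)

lemma vertical_basis: "(0, w) = (\<Sum>\<alpha>\<in>UNIV. cscale (w $ \<alpha>) (0 :: complex^'m, axis \<alpha> 1))"
  by (simp add: prod_eq_iff fst_sum snd_sum vec_eq_iff axis_def if_distrib cong: if_cong)

lemma P_vertical: "x \<in> S \<Longrightarrow> P (0, w) x = (\<Sum>\<alpha>\<in>UNIV. w $ \<alpha> * P (0, axis \<alpha> 1) x)"
  using arg_cong [OF vertical_basis [of w], of "\<lambda>a. P a x"] by (simp only: P_sum P_cscale)

lemma B_horizontal_left: "x \<in> S \<Longrightarrow> B (h, 0) b x = (\<Sum>\<alpha>\<in>UNIV. h $ \<alpha> * B (axis \<alpha> 1, 0) b x)"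
  using arg_cong [OF horizontal_basis [of h], of "\<lambda>a. B a b x"] by (simp only: B_sum_left B_cscale_left)

lemma B_vertical_left: "x \<in> S \<Longrightarrow> B (0, w) b x = (\<Sum>\<alpha>\<in>UNIV. w $ \<alpha> * B (0, axis \<alpha> 1) b x)"
  using arg_cong [OF vertical_basis [of w], of "\<lambda>a. B a b x"] by (simp only: B_sum_left B_cscale_left)

lemma B_vertical_right: "x \<in> S \<Longrightarrow> B a (0, w) x = (\<Sum>\<alpha>\<in>UNIV. cnj (w $ \<alpha>) * B a (0, axis \<alpha> 1) x)"
  using arg_cong [OF B_vertical_left, of x cnj w a] by (simp add: B_cnj)

section \<open>\<open>P\<close> and \<open>B\<close> as Wirtinger derivatives of the metric\<close>

lemma of_real_D1_has_derivative:
  "x \<in> S \<Longrightarrow> ((\<lambda>y. complex_of_real (D1 a y)) has_derivative (\<lambda>b. of_real (D2 a b x))) (at x)"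
  by (rule bounded_linear.has_derivative [OF bounded_linear_of_real D1_has_derivative])

lemma of_real_L_has_derivative:
  "x \<in> S \<Longrightarrow> ((\<lambda>y. complex_of_real (L y)) has_derivative (\<lambda>a. of_real (D1 a x))) (at x)"
  by (rule bounded_linear.has_derivative [OF bounded_linear_of_real L_has_derivative])

lemma P_has_derivative:
  assumes "x \<in> S"
  shows "(P a has_derivative (\<lambda>b. (of_real (D2 a b x) - \<i> * of_real (D2 (cscale \<i> a) b x)) / 2)) (at x)"
  unfolding P_def
  by (rule bounded_linear.has_derivative [OF bounded_linear_divide has_derivative_diff
        [OF of_real_D1_has_derivative has_derivative_mult_right [OF of_real_D1_has_derivative]], OF assms assms])

lemma wd_L: "x \<in> S \<Longrightarrow> wd a (\<lambda>y. complex_of_real (L y)) x = P a x"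
  unfolding P_def
  by (rule wd_eqI [OF of_real_L_has_derivative])

lemma wdb_L: "x \<in> S \<Longrightarrow> wdb a (\<lambda>y. complex_of_real (L y)) x = cnj (P a x)"
  by (simp add: P_def wdb_eqI [OF of_real_L_has_derivative])

lemma wdb_P: "x \<in> S \<Longrightarrow> wdb b (P a) x = B a b x"
  by (simp add: wdb_eqI [OF P_has_derivative] B_def complex_eq_iff)

lemma wd_wdb_L:
  assumes "x \<in> S"
  shows "wd a (wdb b (\<lambda>y. complex_of_real (L y))) x = B a b x"
proof -
  have d: "((\<lambda>y. cnj (P b y)) has_derivative
      (\<lambda>a. cnj ((of_real (D2 b a x) - \<i> * of_real (D2 (cscale \<i> b) a x)) / 2))) (at x)"
    by (rule bounded_linear.has_derivative [OF bounded_linear_cnj P_has_derivative [OF assms]])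
  have "wd a (wdb b (\<lambda>y. complex_of_real (L y))) x = wd a (\<lambda>y. cnj (P b y)) x"
    by (rule wd_cong [OF open_S assms]) (use wdb_L d differentiableI in auto)
  also have "\<dots> = B a b x"
    unfolding wd_eqI [OF d] by (simp add: B_def complex_eq_iff D2_commute [OF assms, of b] D2_commute [OF assms, of "cscale \<i> b"])
  finally show ?thesis .
qed

lemma levi_B: "x \<in> S \<Longrightarrow> levi L x $ \<alpha> $ \<beta> = B (0, axis \<alpha> 1) (0, axis \<beta> 1) x"
  by (simp add: levi_def d_wd wd_wdb_L)

text \<open>Strong pseudoconvexity in terms of \<open>B\<close>. It controls vertical vectors only;
  on the horizontal lift the sign comes from the curvature.\<close>

lemma B_vertical_pos:
  assumes "x \<in> S" "w \<noteq> 0"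
  shows "0 < Re (B (0, w) (0, w) x)"
proof -
  have "hermitian_pos_def (levi L x)"
    using pseudoconvex assms(1) by (cases x) (auto simp: S_def)
  then have "0 < Re (\<Sum>\<alpha>\<in>UNIV. \<Sum>\<beta>\<in>UNIV. levi L x $ \<alpha> $ \<beta> * w $ \<alpha> * cnj (w $ \<beta>))"
    using assms(2) unfolding hermitian_pos_def_def by blast
  also have "(\<Sum>\<alpha>\<in>UNIV. \<Sum>\<beta>\<in>UNIV. levi L x $ \<alpha> $ \<beta> * w $ \<alpha> * cnj (w $ \<beta>)) = B (0, w) (0, w) x"
    by (subst B_vertical_left [OF assms(1)], subst B_vertical_right [OF assms(1)])
       (simp only: levi_B [OF assms(1)] sum_distrib_left mult_ac)
  finally show ?thesis .
qed

section \<open>Chain rule and Euler identities\<close>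

lemma D1_compose_has_derivative:
  fixes F \<phi> :: "'b::real_normed_vector \<Rightarrow> 'm tcoords"
  assumes F: "(F has_derivative F') (at s)" and \<phi>: "(\<phi> has_derivative \<phi>') (at s)" and s: "\<phi> s \<in> S"
  shows "((\<lambda>s. D1 (F s) (\<phi> s)) has_derivative (\<lambda>h. D1 (F' h) (\<phi> s) + D2 (F s) (\<phi>' h) (\<phi> s))) (at s)"
proof -
  \<comment> \<open>Expanding the direction in the real basis turns
    \<open>D1 (F s) (\<phi> s)\<close> into a finite sum of products, to which the product rule
    applies although direction and base point vary together.\<close>
  have 1: "D1 a y = (\<Sum>b\<in>Basis. (a \<bullet> b) * D1 b y)" if "y \<in> S" for a y
  proof -
    have "D1 (\<Sum>b\<in>Basis. (a \<bullet> b) *\<^sub>R b) y = (\<Sum>b\<in>Basis. (a \<bullet> b) * D1 b y)"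
      by (simp add: linear_sum [OF linear_D1 [OF that]] linear_scale [OF linear_D1 [OF that]] del: euclidean_representation)
    then show ?thesis by (simp only: euclidean_representation)
  qed
  have 2: "D2 a c y = (\<Sum>b\<in>Basis. (a \<bullet> b) * D2 b c y)" if "y \<in> S" for a c y
  proof -
    have "D2 (\<Sum>b\<in>Basis. (a \<bullet> b) *\<^sub>R b) c y = (\<Sum>b\<in>Basis. (a \<bullet> b) * D2 b c y)"
      by (simp add: linear_sum [OF linear_D2_left [OF that]] linear_scale [OF linear_D2_left [OF that]] del: euclidean_representation)
    then show ?thesis by (simp only: euclidean_representation)
  qed
  have "((\<lambda>s. \<Sum>b\<in>Basis. (F s \<bullet> b) * D1 b (\<phi> s)) has_derivative
      (\<lambda>h. \<Sum>b\<in>Basis. (F s \<bullet> b) * D2 b (\<phi>' h) (\<phi> s) + (F' h \<bullet> b) * D1 b (\<phi> s))) (at s)"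
    by (intro has_derivative_sum has_derivative_mult has_derivative_inner_left F
        has_derivative_compose [OF \<phi> D1_has_derivative [OF s]])
  moreover have "(\<Sum>b\<in>Basis. (F s \<bullet> b) * D2 b (\<phi>' h) (\<phi> s) + (F' h \<bullet> b) * D1 b (\<phi> s))
      = D1 (F' h) (\<phi> s) + D2 (F s) (\<phi>' h) (\<phi> s)" for h
    by (subst 1 [OF s, of "F' h"], subst 2 [OF s, of "F s"]) (simp only: sum.distrib add.commute)
  ultimately have "((\<lambda>s. \<Sum>b\<in>Basis. (F s \<bullet> b) * D1 b (\<phi> s)) has_derivative
      (\<lambda>h. D1 (F' h) (\<phi> s) + D2 (F s) (\<phi>' h) (\<phi> s))) (at s)"
    by simp
  \<comment> \<open>The expansion needs the base point in \<open>S\<close>, which openness of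
    \<open>S\<close> guarantees near \<open>s\<close>.\<close>
  moreover have "eventually (\<lambda>s. (\<Sum>b\<in>Basis. (F s \<bullet> b) * D1 b (\<phi> s)) = D1 (F s) (\<phi> s)) (at s)"
  proof -
    have "(\<phi> \<longlongrightarrow> \<phi> s) (at s)"
      using has_derivative_continuous [OF \<phi>] by (simp add: continuous_at)
    from topological_tendstoD [OF this open_S s] show ?thesis
      by eventually_elim (rule 1 [symmetric])
  qed
  ultimately show ?thesis
    by (rule has_derivative_transform_eventually) (simp_all add: 1 [OF s, symmetric])
qed

text \<open>Both come from differentiating \<open>L (z, (1 + t * c) *s v)\<close>, which is
  \<open>L (z, v)\<close> times the squared modulus of \<open>1 + t * c\<close>, at
  \<open>t = 0\<close> with \<open>c = 1\<close> and \<open>c = \<i>\<close>.\<close>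

lemma D1_vertical:
  assumes "x \<in> S"
  shows "D1 (0, snd x) x = 2 * L x" and "D1 (0, \<i> *s snd x) x = 0"
proof -
  have *: "((\<lambda>t. (cmod (1 + of_real t * c))\<^sup>2 * L x) has_real_derivative D1 (0, c *s snd x) x) (at 0)" for c
  proof -
    have line: "((\<lambda>t. L (x + t *\<^sub>R e)) has_derivative (\<lambda>t. t * D1 e x)) (at 0)" for e
    proof -
      have 1: "((\<lambda>t. x + t *\<^sub>R e) has_derivative (\<lambda>t. t *\<^sub>R e)) (at 0)"
        by (auto intro!: derivative_eq_intros)
      have "((\<lambda>t. L (x + t *\<^sub>R e)) has_derivative (\<lambda>t. D1 (t *\<^sub>R e) x)) (at 0)"
        using has_derivative_compose [OF 1, of L "\<lambda>a. D1 a x"] L_has_derivative [OF assms] by simp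
      then show ?thesis using linear_scale [OF linear_D1 [OF assms]] by simp
    qed
    have "L (x + t *\<^sub>R (0, c *s snd x)) = (cmod (1 + of_real t * c))\<^sup>2 * L x" for t
    proof -
      have "x + t *\<^sub>R (0, c *s snd x) = (fst x, (1 + of_real t * c) *s snd x)"
        by (simp add: prod_eq_iff scaleR_conv_smult vec_eq_iff algebra_simps)
      moreover have "fst x \<in> U" using assms by (auto simp: S_def)
      ultimately show ?thesis by (simp only: homogeneous prod.collapse)
    qed
    then show ?thesis using line [of "(0, c *s snd x)"] unfolding has_field_derivative_def by (simp only: mult_commute_abs)
  qed
  have "((\<lambda>t. (cmod (1 + of_real t * 1))\<^sup>2 * L x) has_real_derivative 2 * L x) (at 0)"
    unfolding cmod_power2 by (auto intro!: derivative_eq_intros)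
  then show "D1 (0, snd x) x = 2 * L x" using *[of 1] by (simp add: DERIV_unique)
  have "((\<lambda>t. (cmod (1 + of_real t * \<i>))\<^sup>2 * L x) has_real_derivative 0) (at 0)"
    unfolding cmod_power2 by (auto intro!: derivative_eq_intros)
  then show "D1 (0, \<i> *s snd x) x = 0" using *[of \<i>] by (simp add: DERIV_unique)
qed

text \<open>The Euler identities differentiated once more. The direction \<open>(0, snd y)\<close>
  moves with the point \<open>y\<close>, which is the source of the terms containing
  \<open>snd a\<close>.\<close>

lemma D2_vertical:
  assumes "x \<in> S"
  shows "D1 (0, snd a) x + D2 (0, snd x) a x = 2 * D1 a x"
    and "D1 (0, \<i> *s snd a) x + D2 (0, \<i> *s snd x) a x = 0"
proof -
  have "((\<lambda>y::'m tcoords. (0::complex^'m, snd y)) has_derivative (\<lambda>y. (0, snd y))) (at x)"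
    "((\<lambda>y::'m tcoords. (0::complex^'m, \<i> *s snd y)) has_derivative (\<lambda>y. (0, \<i> *s snd y))) (at x)"
    by (rule linear_imp_has_derivative, rule linearI; simp add: prod_eq_iff vec_eq_iff algebra_simps)+
  note d = this [THEN D1_compose_has_derivative, OF has_derivative_ident assms]
  have "((\<lambda>y. D1 (0, snd y) y) has_derivative (\<lambda>a. 2 * D1 a x)) (at x)"
    by (rule has_derivative_transform_within_open [OF has_derivative_mult_right [OF L_has_derivative [OF assms], of 2] open_S assms])
       (simp add: D1_vertical)
  from has_derivative_unique [OF d(1) this] show "D1 (0, snd a) x + D2 (0, snd x) a x = 2 * D1 a x"
    by meson
  have "((\<lambda>y. D1 (0, \<i> *s snd y) y) has_derivative (\<lambda>a. 0)) (at x)"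
    by (rule has_derivative_transform_within_open [OF has_derivative_const open_S assms])
       (simp add: D1_vertical)
  from has_derivative_unique [OF d(2) this] show "D1 (0, \<i> *s snd a) x + D2 (0, \<i> *s snd x) a x = 0"
    by meson
qed

text \<open>The complex Euler relation, from the differentiated identities in the directions
  \<open>a\<close> and \<open>cscale \<i> a\<close>. It holds for horizontal \<open>a\<close> too,
  which later links the horizontal gradient to the Chern-Finsler coefficients.\<close>

lemma P_eq_B:
  assumes "x \<in> S"
  shows "P a x = B a (0, snd x) x"
proof -
  have m: "D1 (0, - snd a) x = - D1 (0, snd a) x"
    using linear_neg [OF linear_D1 [OF assms], of "(0, snd a)"] by simp
  have mm: "\<i> *s (\<i> *s snd a) = - snd a" by (simp add: vec_eq_iff)
  show ?thesis
    unfolding P_def B_def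
    using D2_vertical [OF assms, of a] D2_vertical [OF assms, of "cscale \<i> a"]
    by (simp add: D2_commute [OF assms, of a] D2_commute [OF assms, of "cscale \<i> a"] m mm complex_eq_iff)
qed

lemma P_vertical_self: "x \<in> S \<Longrightarrow> P (0, snd x) x = L x"
  by (simp add: P_def D1_vertical)

lemma L_eq_B: "x \<in> S \<Longrightarrow> B (0, snd x) (0, snd x) x = L x"
  using P_eq_B [of x "(0, snd x)"] P_vertical_self by simp

text \<open>\<open>L\<close> is the value of \<open>B\<close> on the radial vertical vector, where
  pseudoconvexity makes it positive.\<close>

lemma L_pos:
  assumes "x \<in> S"
  shows "0 < L x"
proof -
  have "snd x \<noteq> 0" using assms by (auto simp: S_def)
  then show ?thesis using B_vertical_pos [OF assms] L_eq_B [OF assms] by force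
qed

section \<open>The Levi matrix and the Chern-Finsler coefficients\<close>

lemma levi_invertible:
  assumes "x \<in> S"
  shows "invertible (levi L x)"
proof -
  have "u = 0" if "levi L x *v u = 0" for u
  proof (rule ccontr)
    assume u: "u \<noteq> 0"
    \<comment> \<open>\<open>B\<close> is conjugate linear in its second argument while the matrix
      acts linearly on \<open>u\<close>, so the null vector is conjugated before it is
      tested.\<close>
    define w where "w = (\<chi> i. cnj (u $ i))"
    have w: "w \<noteq> 0" using u by (auto simp: w_def vec_eq_iff)
    have "(\<Sum>\<beta>\<in>UNIV. levi L x $ \<alpha> $ \<beta> * u $ \<beta>) = 0" for \<alpha>
      using that by (simp add: matrix_vector_mult_def vec_eq_iff)
    then have z: "(\<Sum>\<beta>\<in>UNIV. cnj (w $ \<beta>) * B (0, axis \<alpha> 1) (0, axis \<beta> 1) x) = 0" for \<alpha>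
      by (simp add: w_def levi_B [OF assms] mult.commute)
    have "B (0, w) (0, w) x = 0"
      by (subst B_vertical_left [OF assms], subst B_vertical_right [OF assms]) (simp add: z)
    then show False using B_vertical_pos [OF assms w] by simp
  qed
  then show ?thesis
    unfolding invertible_left_inverse matrix_left_invertible_ker by blast
qed

text \<open>Multiplication by the Levi matrix cancels its inverse. The later arguments use this
  linear system in place of the inverse matrix.\<close>

lemma chern_finsler_coeff_levi:
  assumes "x \<in> S"
  shows "(\<Sum>\<beta>\<in>UNIV. chern_finsler_coeff L \<beta> \<alpha> x * B (0, axis \<beta> 1) (0, axis \<gamma> 1) x) = B (axis \<alpha> 1, 0) (0, axis \<gamma> 1) x"
proof -
  define b where "b \<delta> = B (axis \<alpha> 1, 0) (0, axis \<delta> 1) x" for \<delta>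
  have c: "chern_finsler_coeff L \<beta> \<alpha> x = (\<Sum>\<delta>\<in>UNIV. matrix_inv (levi L x) $ \<delta> $ \<beta> * b \<delta>)" for \<beta>
    by (simp add: chern_finsler_coeff_def d_wd wd_wdb_L [OF assms] b_def)
  have "(\<Sum>\<beta>\<in>UNIV. chern_finsler_coeff L \<beta> \<alpha> x * levi L x $ \<beta> $ \<gamma>)
      = (\<Sum>\<beta>\<in>UNIV. \<Sum>\<delta>\<in>UNIV. b \<delta> * (matrix_inv (levi L x) $ \<delta> $ \<beta> * levi L x $ \<beta> $ \<gamma>))"
    by (simp add: c sum_distrib_right sum_distrib_left mult_ac)
  also have "\<dots> = (\<Sum>\<delta>\<in>UNIV. b \<delta> * (matrix_inv (levi L x) ** levi L x) $ \<delta> $ \<gamma>)"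
    by (subst sum.swap) (simp add: matrix_matrix_mult_def sum_distrib_left)
  also have "\<dots> = b \<gamma>"
    by (simp add: matrix_inv_inverse [OF levi_invertible [OF assms]] mat_def if_distrib cong: if_cong)
  finally show ?thesis by (simp add: levi_B [OF assms] b_def)
qed

lemma of_real_D2_differentiable: "x \<in> S \<Longrightarrow> (\<lambda>y. complex_of_real (D2 a b y)) differentiable (at x)"
  using smooth_on_imp_differentiable [OF smooth_D2] bounded_linear.has_derivative [OF bounded_linear_of_real]
  unfolding differentiable_def by blast

lemma B_differentiable: "x \<in> S \<Longrightarrow> B a b differentiable (at x)"
  unfolding B_def of_real_add of_real_diff by (simp add: of_real_D2_differentiable)

lemma chern_finsler_coeff_differentiable:
  assumes "x \<in> S"
  shows "chern_finsler_coeff L \<beta> \<alpha> differentiable (at x)"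
proof -
  \<comment> \<open>The transposed Levi matrix, because the linear system sums over the unbarred
    index; \<open>N\<close> replaces its column \<beta> by the right side. Cramer's rule then gives
    the coefficient as a quotient of determinants in entries of \<open>B\<close>.\<close>
  define M where "M y = (\<chi> \<gamma> \<beta>. B (0, axis \<beta> 1) (0, axis \<gamma> 1) y)" for y
  define N where "N y = (\<chi> \<gamma> \<delta>. if \<delta> = \<beta> then B (axis \<alpha> 1, 0) (0, axis \<gamma> 1) y else M y $ \<gamma> $ \<delta>)" for y
  have M: "M y = transpose (levi L y)" if "y \<in> S" for y
    by (simp add: M_def transpose_def vec_eq_iff levi_B [OF that])
  have nz: "det (M y) \<noteq> 0" if "y \<in> S" for y
    using levi_invertible [OF that] by (simp add: M [OF that] invertible_det_nz)
  have eq: "det (N y) / det (M y) = chern_finsler_coeff L \<beta> \<alpha> y" if y: "y \<in> S" for y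
  proof -
    have "M y *v (\<chi> \<beta>. chern_finsler_coeff L \<beta> \<alpha> y) = (\<chi> \<gamma>. B (axis \<alpha> 1, 0) (0, axis \<gamma> 1) y)"
      using chern_finsler_coeff_levi [OF y, of \<alpha>]
      by (simp add: matrix_vector_mult_def M_def vec_eq_iff mult.commute)
    from arg_cong [OF this [unfolded cramer [OF nz [OF y]]], of "\<lambda>v. v $ \<beta>"] show ?thesis
      by (simp add: N_def cong: if_cong)
  qed
  have "(\<lambda>y. N y $ i $ j) differentiable (at x)" "(\<lambda>y. M y $ i $ j) differentiable (at x)" for i j
    by (cases "j = \<beta>"; simp add: N_def M_def B_differentiable [OF assms])+
  then have "(\<lambda>y. det (N y)) differentiable (at x)" "(\<lambda>y. det (M y)) differentiable (at x)"
    by (auto intro: det_differentiable)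
  then have "(\<lambda>y. det (N y) / det (M y)) differentiable (at x)"
    using nz [OF assms] by simp
  then obtain D where "((\<lambda>y. det (N y) / det (M y)) has_derivative D) (at x)"
    unfolding differentiable_def by blast
  then have "(chern_finsler_coeff L \<beta> \<alpha> has_derivative D) (at x)"
    by (rule has_derivative_transform_within_open [OF _ open_S assms eq])
  then show ?thesis by (rule differentiableI)
qed

section \<open>The horizontal lift\<close>

definition G :: "complex^'m \<Rightarrow> 'm tcoords \<Rightarrow> complex^'m" where
  "G h x = (\<chi> \<beta>. \<Sum>\<alpha>\<in>UNIV. chern_finsler_coeff L \<beta> \<alpha> x * h $ \<alpha>)"

lemma G_axis: "G (axis \<alpha> 1) x $ \<beta> = chern_finsler_coeff L \<beta> \<alpha> x"
  by (simp add: G_def axis_def if_distrib cong: if_cong)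

text \<open>This says that the lift \<open>(h, - G h x)\<close> is orthogonal to all vertical
  vectors. On the vertical basis it is the linear system of the Chern-Finsler coefficients.\<close>

lemma B_G:
  assumes "x \<in> S"
  shows "B (0, G h x) (0, w) x = B (h, 0) (0, w) x"
proof -
  have 1: "B (0, G h x) (0, axis \<gamma> 1) x = B (h, 0) (0, axis \<gamma> 1) x" for \<gamma>
  proof -
    have "B (0, G h x) (0, axis \<gamma> 1) x
        = (\<Sum>\<beta>\<in>UNIV. \<Sum>\<alpha>\<in>UNIV. h $ \<alpha> * (chern_finsler_coeff L \<beta> \<alpha> x * B (0, axis \<beta> 1) (0, axis \<gamma> 1) x))"
      by (subst B_vertical_left [OF assms]) (simp add: G_def sum_distrib_right mult_ac)
    also have "\<dots> = (\<Sum>\<alpha>\<in>UNIV. h $ \<alpha> * B (axis \<alpha> 1, 0) (0, axis \<gamma> 1) x)"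
      by (subst sum.swap) (simp add: chern_finsler_coeff_levi [OF assms] flip: sum_distrib_left)
    also have "\<dots> = B (h, 0) (0, axis \<gamma> 1) x"
      by (rule B_horizontal_left [OF assms, symmetric])
    finally show ?thesis .
  qed
  have "B (0, G h x) (0, w) x = (\<Sum>\<gamma>\<in>UNIV. cnj (w $ \<gamma>) * B (0, G h x) (0, axis \<gamma> 1) x)"
    by (rule B_vertical_right [OF assms])
  also have "\<dots> = (\<Sum>\<gamma>\<in>UNIV. cnj (w $ \<gamma>) * B (h, 0) (0, axis \<gamma> 1) x)"
    by (simp only: 1)
  also have "\<dots> = B (h, 0) (0, w) x"
    by (rule B_vertical_right [OF assms, symmetric])
  finally show ?thesis .
qed

text \<open>The horizontal lift of \<open>snd x\<close>.\<close>

definition chi :: "'m tcoords \<Rightarrow> 'm tcoords" where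
  "chi x = (snd x, - G (snd x) x)"

lemma chi_eq: "chi x = (snd x, 0) + cscale (-1) (0, G (snd x) x)"
  by (simp add: chi_def vec_eq_iff)

lemma B_chi_vertical: "x \<in> S \<Longrightarrow> B (chi x) (0, w) x = 0"
  unfolding chi_eq by (simp only: B_add_left B_cscale_left B_G) simp

lemma B_vertical_chi: "x \<in> S \<Longrightarrow> B (0, w) (chi x) x = 0"
  by (metis B_chi_vertical B_cnj complex_cnj_zero)

text \<open>By \<open>P_eq_B\<close> both sides are Levi products with the vertical vector
  \<open>(0, snd x)\<close>, and \<open>B_G\<close> identifies them.\<close>

lemma P_horizontal_eq: "x \<in> S \<Longrightarrow> P (h, 0) x = P (0, G h x) x"
  by (simp only: P_eq_B B_G)

lemma P_chi: "x \<in> S \<Longrightarrow> P (chi x) x = 0"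
  by (simp only: P_eq_B B_chi_vertical)

text \<open>\<open>wdb\<close> is conjugate linear in its direction, so expanding
  \<open>chi x\<close> in coordinates produces precisely the conjugated coefficients of
  \<open>delta_bar\<close>.\<close>

lemma delta_bar_contract:
  assumes "F differentiable (at x)"
  shows "(\<Sum>\<nu>\<in>UNIV. delta_bar L \<nu> F x * cnj (snd x $ \<nu>)) = wdb (chi x) F x"
proof -
  have s: "wdb (\<Sum>i\<in>I. cscale (c i) (a i)) F x = (\<Sum>i\<in>I. cnj (c i) * wdb (a i) F x)" for I :: "'m set" and c a
  proof (induction I rule: infinite_finite_induct)
    case (insert i I)
    then show ?case by (simp add: wdb_add [OF assms] wdb_cscale [OF assms])
  qed (use wdb_add [OF assms, of 0 0] in auto)
  have h: "wdb (h, 0) F x = (\<Sum>\<nu>\<in>UNIV. cnj (h $ \<nu>) * d_zbar \<nu> F x)" for h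
    by (subst horizontal_basis) (simp only: s d_wd)
  have v: "wdb (0, w) F x = (\<Sum>\<nu>\<in>UNIV. cnj (w $ \<nu>) * d_vbar \<nu> F x)" for w
    by (subst vertical_basis) (simp only: s d_wd)
  have "wdb (chi x) F x = wdb (snd x, 0) F x - wdb (0, G (snd x) x) F x"
    unfolding chi_eq wdb_add [OF assms] wdb_cscale [OF assms] by simp
  also have "wdb (0, G (snd x) x) F x = (\<Sum>\<beta>\<in>UNIV. \<Sum>\<nu>\<in>UNIV. cnj (chern_finsler_coeff L \<beta> \<nu> x) * d_vbar \<beta> F x * cnj (snd x $ \<nu>))"
    by (simp add: v G_def sum_distrib_left sum_distrib_right mult_ac)
  also have "\<dots> = (\<Sum>\<nu>\<in>UNIV. (\<Sum>\<beta>\<in>UNIV. cnj (chern_finsler_coeff L \<beta> \<nu> x) * d_vbar \<beta> F x) * cnj (snd x $ \<nu>))"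
    by (subst sum.swap) (simp add: sum_distrib_right)
  finally show ?thesis
    by (simp add: h delta_bar_def left_diff_distrib right_diff_distrib sum_subtractf mult.commute)
qed

text \<open>Differentiating \<open>L\<^sub>\<alpha> \<Gamma>\<^sup>\<alpha>\<^sub>;\<^sub>\<mu> = L\<^sub>;\<^sub>\<mu>\<close> along the conjugate of \<open>\<chi>\<close>, where \<open>L\<^sub>\<alpha>\<close> is stationary.\<close>

lemma chern_finsler_coeff_chi:
  assumes "x \<in> S"
  shows "(\<Sum>\<alpha>\<in>UNIV. P (0, axis \<alpha> 1) x * wdb (chi x) (chern_finsler_coeff L \<alpha> \<mu>) x) = B (axis \<mu> 1, 0) (chi x) x"
proof -
  define P' where "P' a b = (complex_of_real (D2 a b x) - \<i> * of_real (D2 (cscale \<i> a) b x)) / 2" for a b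
  define c' where "c' \<alpha> = frechet_derivative (chern_finsler_coeff L \<alpha> \<mu>) (at x)" for \<alpha>
  have c': "(chern_finsler_coeff L \<alpha> \<mu> has_derivative c' \<alpha>) (at x)" for \<alpha>
    unfolding c'_def using chern_finsler_coeff_differentiable [OF assms] frechet_derivative_works by blast
  have P': "(P a has_derivative P' a) (at x)" for a
    unfolding P'_def by (rule P_has_derivative [OF assms])
  let ?F = "\<lambda>y. \<Sum>\<alpha>\<in>UNIV. P (0, axis \<alpha> 1) y * chern_finsler_coeff L \<alpha> \<mu> y"
  have d: "(?F has_derivative
      (\<lambda>b. \<Sum>\<alpha>\<in>UNIV. P (0, axis \<alpha> 1) x * c' \<alpha> b + P' (0, axis \<alpha> 1) b * chern_finsler_coeff L \<alpha> \<mu> x)) (at x)"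
    by (intro has_derivative_sum has_derivative_mult P' c')
  have "wdb (chi x) ?F x = (\<Sum>\<alpha>\<in>UNIV. P (0, axis \<alpha> 1) x * wdb (chi x) (chern_finsler_coeff L \<alpha> \<mu>) x
      + wdb (chi x) (P (0, axis \<alpha> 1)) x * chern_finsler_coeff L \<alpha> \<mu> x)"
    unfolding wdb_eqI [OF d] wdb_eqI [OF c'] wdb_eqI [OF P'] sum_divide_distrib sum_distrib_left
      sum.distrib [symmetric]
    by (rule sum.cong) (simp_all add: field_simps)
  also have "\<dots> = (\<Sum>\<alpha>\<in>UNIV. P (0, axis \<alpha> 1) x * wdb (chi x) (chern_finsler_coeff L \<alpha> \<mu>) x)"
    by (simp add: wdb_P [OF assms] B_vertical_chi [OF assms])
  also have "wdb (chi x) ?F x = wdb (chi x) (P (axis \<mu> 1, 0)) x"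
  proof (rule wdb_cong [OF open_S assms])
    show "?F y = P (axis \<mu> 1, 0) y" if "y \<in> S" for y
      using P_horizontal_eq [OF that, of "axis \<mu> 1"] P_vertical [OF that, of "G (axis \<mu> 1) y"]
      by (simp add: G_axis mult.commute)
    show "P (axis \<mu> 1, 0) differentiable (at x)"
      using P' differentiableI by blast
  qed
  also have "\<dots> = B (axis \<mu> 1, 0) (chi x) x"
    by (rule wdb_P [OF assms])
  finally show ?thesis by simp
qed

section \<open>Curvature as the Levi form on the horizontal lift\<close>

lemma hsc_coords_eq:
  assumes "x \<in> S"
  shows "hsc_coords L x = - 2 / (L x)\<^sup>2 * Re (B (chi x) (chi x) x)"
proof -
  have "(\<Sum>\<alpha>\<in>UNIV. \<Sum>\<mu>\<in>UNIV. \<Sum>\<nu>\<in>UNIV.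
           d_v \<alpha> (\<lambda>y. complex_of_real (L y)) x * delta_bar L \<nu> (chern_finsler_coeff L \<alpha> \<mu>) x
           * snd x $ \<mu> * cnj (snd x $ \<nu>))
      = (\<Sum>\<alpha>\<in>UNIV. \<Sum>\<mu>\<in>UNIV. snd x $ \<mu> * (P (0, axis \<alpha> 1) x *
           (\<Sum>\<nu>\<in>UNIV. delta_bar L \<nu> (chern_finsler_coeff L \<alpha> \<mu>) x * cnj (snd x $ \<nu>))))"
    by (simp add: d_wd wd_L [OF assms] sum_distrib_left mult_ac)
  also have "\<dots> = (\<Sum>\<mu>\<in>UNIV. snd x $ \<mu> * (\<Sum>\<alpha>\<in>UNIV. P (0, axis \<alpha> 1) x * wdb (chi x) (chern_finsler_coeff L \<alpha> \<mu>) x))"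
    by (subst sum.swap) (simp add: delta_bar_contract [OF chern_finsler_coeff_differentiable [OF assms]] sum_distrib_left)
  also have "\<dots> = B (snd x, 0) (chi x) x"
    using B_horizontal_left [OF assms, of "snd x" "chi x"] by (simp add: chern_finsler_coeff_chi [OF assms])
  \<comment> \<open>Adding the vertical part of \<open>chi x\<close> changes nothing, since vertical
    vectors are orthogonal to \<open>chi x\<close>.\<close>
  also have "\<dots> = B ((snd x, 0) + cscale (-1) (0, G (snd x) x)) (chi x) x"
    by (simp only: B_add_left [OF assms] B_cscale_left [OF assms] B_vertical_chi [OF assms]) simp
  also have "\<dots> = B (chi x) (chi x) x"
    by (simp only: chi_eq [symmetric])
  finally show ?thesis by (simp add: hsc_coords_def)
qed

lemma B_self_real: "x \<in> S \<Longrightarrow> B a a x = complex_of_real (Re (B a a x))"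
  by (metis B_cnj complex_eq_iff cnj.sel(2) complex_cnj_cancel_iff Im_complex_of_real Re_complex_of_real neg_equal_zero)

text \<open>Cauchy-Schwarz for the positive form \<open>B\<close> on vertical vectors, applied to
  \<open>(0, w)\<close> and \<open>(0, snd x)\<close>: their product is \<open>P (0, w) x\<close>,
  and \<open>B\<close> of the second with itself is \<open>L x\<close>.\<close>

lemma B_Cauchy_Schwarz:
  assumes "x \<in> S"
  shows "(cmod (P (0, w) x))\<^sup>2 \<le> L x * Re (B (0, w) (0, w) x)"
proof -
  define c where "c = P (0, w) x"
  define l where "l = complex_of_real (L x)"
  have l: "L x > 0" using L_pos [OF assms] .
  have cv: "B (0, w) (0, snd x) x = c" "B (0, snd x) (0, w) x = cnj c" "B (0, snd x) (0, snd x) x = l"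
    using P_eq_B [OF assms, of "(0, w)"] B_cnj [OF assms, of "(0, w)" "(0, snd x)"] L_eq_B [OF assms]
    by (simp_all add: c_def l_def)
  \<comment> \<open>\<open>L x\<close> times the component of \<open>(0, w)\<close> orthogonal to
    \<open>(0, snd x)\<close>; the factor avoids a division.\<close>
  define u where "u = cscale l (0, w) + cscale (- c) (0, snd x)"
  have "B u u x = l * cnj l * B (0, w) (0, w) x - l * cnj c * c - c * cnj l * cnj c + c * cnj c * l"
    unfolding u_def
    by (simp only: B_add_left [OF assms] B_add_right [OF assms] B_cscale_left [OF assms] B_cscale_right [OF assms] cv)
       (simp add: algebra_simps)
  also have "\<dots> = l * (l * B (0, w) (0, w) x - c * cnj c)"
    by (simp add: l_def algebra_simps)
  also have "\<dots> = of_real (L x * (L x * Re (B (0, w) (0, w) x) - (cmod c)\<^sup>2))"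
    by (subst B_self_real [OF assms]) (simp add: l_def complex_norm_square [symmetric])
  finally have "Re (B u u x) = L x * (L x * Re (B (0, w) (0, w) x) - (cmod c)\<^sup>2)" by simp
  moreover have "0 \<le> Re (B u u x)"
  proof -
    have u: "u = (0, snd u)" by (simp add: u_def prod_eq_iff)
    have "B 0 0 x = 0" by (rule B_zero_left [OF assms])
    then show ?thesis using B_vertical_pos [OF assms, of "snd u"] u
      by (metis less_eq_real_def order_refl zero_complex.sel(1) zero_prod_def)
  qed
  ultimately show ?thesis using l by (simp add: zero_le_mult_iff c_def)
qed

text \<open>The condition on \<open>a\<close> holds for the velocity of a lifted curve and forces
  \<open>a\<close> to differ from \<open>chi x\<close> by a vertical vector, so the Levi form of
  \<open>a\<close> has no mixed terms.\<close>

lemma curvature_inequality: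
  assumes x: "x \<in> S" and a: "fst a = snd x" and K: "hsc_coords L x \<le> K"
  shows "- 2 * K * (L x) ^ 3 \<le> L x * (D2 a a x + D2 (cscale \<i> a) (cscale \<i> a) x) - (D1 a x)\<^sup>2 - (D1 (cscale \<i> a) x)\<^sup>2"
proof -
  define w where "w = snd a + G (snd x) x"
  have aeq: "a = chi x + (0, w)" using a by (simp add: prod_eq_iff chi_def w_def)
  have l: "L x > 0" using L_pos [OF x] .
  have "Re (B a a x) = Re (B (chi x) (chi x) x) + Re (B (0, w) (0, w) x)"
    unfolding aeq by (simp only: B_add_left [OF x] B_add_right [OF x] B_chi_vertical [OF x] B_vertical_chi [OF x]) simp
  moreover have "P a x = P (0, w) x" unfolding aeq by (simp only: P_add [OF x] P_chi [OF x]) simp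
  moreover have "(cmod (P (0, w) x))\<^sup>2 \<le> L x * Re (B (0, w) (0, w) x)" by (rule B_Cauchy_Schwarz [OF x])
  moreover have "- K * (L x)\<^sup>2 / 2 \<le> Re (B (chi x) (chi x) x)"
    using K l by (simp add: hsc_coords_eq [OF x] field_simps)
  then have "L x * (- K * (L x)\<^sup>2 / 2) \<le> L x * Re (B (chi x) (chi x) x)"
    using l by (intro mult_left_mono) auto
  ultimately have "- K * (L x) ^ 3 / 2 \<le> L x * Re (B a a x) - (cmod (P a x))\<^sup>2"
    by (simp add: algebra_simps power2_eq_square power3_eq_cube)
  \<comment> \<open>The factor 4 is that of the Laplacian against the mixed Wirtinger derivative;
    the gradient terms carry it because \<open>P\<close> contains a factor 1/2.\<close>
  moreover have "L x * (D2 a a x + D2 (cscale \<i> a) (cscale \<i> a) x) - (D1 a x)\<^sup>2 - (D1 (cscale \<i> a) x)\<^sup>2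
      = 4 * (L x * Re (B a a x) - (cmod (P a x))\<^sup>2)"
    by (simp add: B_def P_def cmod_power2 power_divide algebra_simps)
  ultimately show ?thesis by simp
qed

text \<open>\<open>\<psi>\<close> and \<open>\<theta>\<close> are the complex velocity and
  acceleration of the lifted curve \<open>\<phi>\<close>; \<open>tangent\<close> says that at
  \<open>\<zeta>\<close> the vector part of \<open>\<phi>\<close> is the velocity of its base
  curve.\<close>

lemma curve_log_laplacian:
  fixes \<phi> \<psi> \<theta> :: "complex \<Rightarrow> 'm tcoords"
  assumes W: "open W" "\<zeta> \<in> W"
    and \<phi>S: "\<And>s. s \<in> W \<Longrightarrow> \<phi> s \<in> S" and u: "\<And>s. s \<in> W \<Longrightarrow> u s = L (\<phi> s)"
    and \<phi>: "\<And>s. s \<in> W \<Longrightarrow> (\<phi> has_derivative (\<lambda>h. cscale h (\<psi> s))) (at s)"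
    and \<psi>: "\<And>s. s \<in> W \<Longrightarrow> (\<psi> has_derivative (\<lambda>h. cscale h (\<theta> s))) (at s)"
    and tangent: "fst (\<psi> \<zeta>) = snd (\<phi> \<zeta>)" and K: "hsc_coords L (\<phi> \<zeta>) \<le> K"
  shows "log_laplacian_ge (- 2 * K) u \<zeta>"
proof -
  obtain d where d: "d > 0" "ball \<zeta> d \<subseteq> W" using W open_contains_ball by blast
  have inW: "\<zeta> + of_real t * e \<in> W" if "e \<in> {1, \<i>}" "\<bar>t\<bar> < d" for e t
  proof -
    have "\<zeta> + of_real t * e \<in> ball \<zeta> d" using that by (auto simp: dist_norm norm_mult)
    then show ?thesis using d by blast
  qed
  define u' where "u' e t = D1 (cscale e (\<psi> (\<zeta> + of_real t * e))) (\<phi> (\<zeta> + of_real t * e))" for e t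
  \<comment> \<open>The acceleration enters with the square of \<open>e\<close>, so its
    contributions for \<open>e = 1\<close> and \<open>e = \<i>\<close> cancel in the
    Laplacian.\<close>
  define u'' where "u'' e = D1 (cscale e (cscale e (\<theta> \<zeta>))) (\<phi> \<zeta>) + D2 (cscale e (\<psi> \<zeta>)) (cscale e (\<psi> \<zeta>)) (\<phi> \<zeta>)" for e
  have \<zeta>S: "\<phi> \<zeta> \<in> S" using \<phi>S W by blast
  have 1: "0 < u (\<zeta> + of_real t * e)" "((\<lambda>t. u (\<zeta> + of_real t * e)) has_real_derivative u' e t) (at t)"
    if "e \<in> {1, \<i>}" "\<bar>t\<bar> < d" for e t
  proof -
    have w: "\<zeta> + of_real t * e \<in> W" by (rule inW [OF that])
    show "0 < u (\<zeta> + of_real t * e)" using u [OF w] L_pos [OF \<phi>S [OF w]] by simp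
    have "((\<lambda>t. L (\<phi> (\<zeta> + of_real t * e))) has_derivative
        (\<lambda>r. D1 (r *\<^sub>R cscale e (\<psi> (\<zeta> + of_real t * e))) (\<phi> (\<zeta> + of_real t * e)))) (at t)"
      by (rule has_derivative_compose [OF has_derivative_cscale_line [OF \<phi> [OF w]] L_has_derivative [OF \<phi>S [OF w]]])
    then have "((\<lambda>t. L (\<phi> (\<zeta> + of_real t * e))) has_real_derivative u' e t) (at t)"
      by (simp add: has_field_derivative_def u'_def linear_scale [OF linear_D1 [OF \<phi>S [OF w]]] mult_commute_abs)
    then show "((\<lambda>t. u (\<zeta> + of_real t * e)) has_real_derivative u' e t) (at t)"
      by (rule has_field_derivative_transform_within_open [where S = "ball 0 d"])
         (use that u inW in auto)
  qed
  have 2: "(u' e has_real_derivative u'' e) (at 0)" if e: "e \<in> {1, \<i>}" for e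
  proof -
    have w: "\<zeta> + of_real 0 * e \<in> W" using W by simp
    have "((\<lambda>t. cscale e (\<psi> (\<zeta> + of_real t * e))) has_derivative
        (\<lambda>r. cscale e (r *\<^sub>R cscale e (\<theta> (\<zeta> + of_real 0 * e))))) (at 0)"
      by (rule has_derivative_compose [OF has_derivative_cscale_line [OF \<psi> [OF w]] linear_imp_has_derivative [OF linear_cscale]])
    from D1_compose_has_derivative [OF this has_derivative_cscale_line [OF \<phi> [OF w]] \<phi>S [OF w]]
    have "((\<lambda>t. u' e t) has_derivative (\<lambda>r. r * u'' e)) (at 0)"
      by (simp add: u'_def u''_def linear_scale [OF linear_cscale] linear_scale [OF linear_D1 [OF \<zeta>S]]
          linear_scale [OF linear_D2 [OF \<zeta>S]] distrib_left)
    then show ?thesis by (simp add: has_field_derivative_def mult_commute_abs)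
  qed
  have one: "cscale 1 a = a" for a :: "'m tcoords" by (simp add: cscale_def)
  have 3: "- 2 * K * u \<zeta> ^ 3 \<le> u \<zeta> * (u'' 1 + u'' \<i>) - (u' 1 0)\<^sup>2 - (u' \<i> 0)\<^sup>2"
    using curvature_inequality [OF \<zeta>S tangent K]
    by (simp add: u [OF W(2)] u'_def u''_def one linear_neg [OF linear_D1 [OF \<zeta>S]])
  show ?thesis unfolding log_laplacian_ge_def using d(1) 1 2 3 by blast
qed

end

section \<open>Holomorphic curves in a Finsler manifold\<close>

context complex_manifold
begin

section \<open>Charts, coordinate changes and tangent vectors\<close>

lemma chart_inj_on: "c \<in> A \<Longrightarrow> inj_on (snd c) (fst c)"
  using homeomorphic_imp_injective_map [OF chart_homeomorphic] chart_domain openin_subset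
  by (metis topspace_subtopology_subset)

lemma chart_inv_left: "c \<in> A \<Longrightarrow> p \<in> fst c \<Longrightarrow> chart_inv c (snd c p) = p"
  unfolding chart_inv_def by (simp add: chart_inj_on)

lemma chart_inv_in: "z \<in> chart_image c \<Longrightarrow> chart_inv c z \<in> fst c"
  unfolding chart_inv_def chart_image_def by (rule inv_into_into)

lemma chart_inv_right: "z \<in> chart_image c \<Longrightarrow> snd c (chart_inv c z) = z"
  unfolding chart_inv_def chart_image_def by (rule f_inv_into_f)

lemma chart_in_image: "p \<in> fst c \<Longrightarrow> snd c p \<in> chart_image c"
  unfolding chart_image_def by blast

lemma chart_domain_subset: "c \<in> A \<Longrightarrow> fst c \<subseteq> topspace X"
  using chart_domain openin_subset by blast

lemma open_chart_overlap:
  assumes "c \<in> A" "openin X T"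
  shows "open (snd c ` (fst c \<inter> T))"
proof -
  have "openin (subtopology X (fst c)) (fst c \<inter> T)"
    using assms(2) by (metis Int_commute openin_subtopology_Int)
  then have "openin (top_of_set (chart_image c)) (snd c ` (fst c \<inter> T))"
    using homeomorphic_imp_open_map [OF chart_homeomorphic [OF assms(1)]] unfolding open_map_def by blast
  then show ?thesis using open_chart_image [OF assms(1)] openin_open_eq by blast
qed

lemma transition_apply: "c \<in> A \<Longrightarrow> p \<in> fst c \<Longrightarrow> transition c d (snd c p) = snd d p"
  by (simp add: transition_def chart_inv_left)

abbreviation dtrans :: "('a, 'm) chart \<Rightarrow> ('a, 'm) chart \<Rightarrow> 'a \<Rightarrow> complex^'m \<Rightarrow> complex^'m" where
  "dtrans c d p \<equiv> frechet_derivative (transition c d) (at (snd c p))"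

lemma
  assumes "c \<in> charts_at A p" "d \<in> charts_at A p"
  shows transition_has_derivative: "(transition c d has_derivative dtrans c d p) (at (snd c p))"
    and dtrans_smult: "dtrans c d p (k *s v) = k *s dtrans c d p v"
proof -
  have "hol_on (transition c d) (snd c ` (fst c \<inter> fst d))" "snd c p \<in> snd c ` (fst c \<inter> fst d)"
    using assms charts_compatible by (auto simp: charts_at_def)
  then obtain D where D: "(transition c d has_derivative D) (at (snd c p))" "\<And>k v. D (k *s v) = k *s D v"
    unfolding hol_on_def by blast
  then have eq: "dtrans c d p = D" by (metis frechet_derivative_at)
  show "(transition c d has_derivative dtrans c d p) (at (snd c p))" "dtrans c d p (k *s v) = k *s dtrans c d p v"
    using D by (simp_all add: eq)
qed

text \<open>The chain rule on the open coordinate image of the overlap. It makes the family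
  generated by one coordinate vector a tangent vector.\<close>

lemma dtrans_cocycle:
  assumes c: "c \<in> charts_at A p" and d: "d \<in> charts_at A p" and e: "e \<in> charts_at A p"
  shows "dtrans c e p v = dtrans d e p (dtrans c d p v)"
proof -
  have mem: "c \<in> A" "d \<in> A" "e \<in> A" "p \<in> fst c" "p \<in> fst d" "p \<in> fst e"
    using assms by (auto simp: charts_at_def)
  have cd: "transition c d (snd c p) = snd d p" using mem by (simp add: transition_apply)
  have "((\<lambda>z. transition d e (transition c d z)) has_derivative (\<lambda>v. dtrans d e p (dtrans c d p v))) (at (snd c p))"
    by (rule has_derivative_compose [OF transition_has_derivative [OF c d]])
       (use transition_has_derivative [OF d e] cd in simp)
  then have "(transition c e has_derivative (\<lambda>v. dtrans d e p (dtrans c d p v))) (at (snd c p))"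
    by (rule has_derivative_transform_within_open [OF _ open_chart_overlap [OF mem(1) chart_domain [OF mem(2)]]])
       (use mem in \<open>auto simp: transition_apply\<close>)
  then show ?thesis
    by (rule fun_cong [OF has_derivative_unique [OF transition_has_derivative [OF c e]]])
qed

lemma tvec_of_coords_apply:
  assumes "c \<in> charts_at A p"
  shows "tvec_of_coords A c (snd c p) v = (\<lambda>d. if d \<in> charts_at A p then dtrans c d p v else 0)"
  using assms by (simp add: tvec_of_coords_def charts_at_def chart_inv_left)

lemma tvec_of_coords_in_hol_tangent:
  assumes "c \<in> charts_at A p"
  shows "tvec_of_coords A c (snd c p) v \<in> hol_tangent A p"
  by (simp add: hol_tangent_def tvec_of_coords_apply [OF assms]) (blast intro: dtrans_cocycle [OF assms])

lemma tvec_of_coords_smult: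
  assumes "c \<in> charts_at A p"
  shows "tvec_of_coords A c (snd c p) (k *s v) = (\<lambda>d. k *s tvec_of_coords A c (snd c p) v d)"
  by (auto simp: tvec_of_coords_apply [OF assms] dtrans_smult [OF assms])

lemma in_coords_apply:
  assumes "c \<in> charts_at A p"
  shows "in_coords A H c (snd c p, v) = H p (tvec_of_coords A c (snd c p) v)"
  using assms by (simp add: in_coords_def charts_at_def chart_inv_left)

text \<open>Only homogeneity takes work: it is assumed for tangent vectors and passes to coordinates
  because \<open>tvec_of_coords\<close> commutes with complex scaling.\<close>

lemma finsler_coords_in_coords:
  assumes H: "complex_finsler X A H" "strongly_pseudoconvex A H" and c: "c \<in> A"
  shows "finsler_coords (in_coords A H c) (chart_image c)"
proof
  show "open (chart_image c)" by (rule open_chart_image [OF c])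
  show "smooth_on (chart_image c \<times> - {0}) (in_coords A H c)"
    using H(1) c by (simp add: complex_finsler_def)
  show "hermitian_pos_def (levi (in_coords A H c) (z, v))" if "z \<in> chart_image c" "v \<noteq> 0" for z v
    using H(2) c that by (simp add: strongly_pseudoconvex_def)
  show "in_coords A H c (z, k *s v) = (cmod k)\<^sup>2 * in_coords A H c (z, v)" if z: "z \<in> chart_image c" for z k v
  proof -
    define p where "p = chart_inv c z"
    have p: "c \<in> charts_at A p" "z = snd c p"
      using chart_inv_in [OF z] chart_inv_right [OF z] c by (auto simp: p_def charts_at_def)
    have "p \<in> topspace X" using p chart_domain_subset [OF c] by (auto simp: charts_at_def)
    then have "H p (\<lambda>d. k *s tvec_of_coords A c (snd c p) v d) = (cmod k)\<^sup>2 * H p (tvec_of_coords A c (snd c p) v)"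
      using H(1) tvec_of_coords_in_hol_tangent [OF p(1)] unfolding complex_finsler_def by blast
    then show ?thesis unfolding p(2) in_coords_apply [OF p(1)] tvec_of_coords_smult [OF p(1)] .
  qed
qed

end

text \<open>Holomorphy is stated componentwise in each chart so that one-variable complex analysis
  supplies the higher derivatives of the curve.\<close>

locale holomorphic_curve = complex_manifold X A
  for X :: "'a topology" and A :: "('a, 'm::finite) chart set" +
  fixes g :: "complex \<Rightarrow> 'a"
  assumes continuous: "continuous_map euclidean X g"
    and holomorphic: "c \<in> A \<Longrightarrow> (\<lambda>s. snd c (g s) $ i) holomorphic_on g -` fst c"
begin

lemma open_vimage_chart:
  assumes "c \<in> A"
  shows "open (g -` fst c)"
proof -
  have "openin euclidean {x \<in> topspace euclidean. g x \<in> fst c}"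
    by (rule openin_continuous_map_preimage [OF continuous chart_domain [OF assms]])
  then show ?thesis by (simp add: vimage_def)
qed

definition vel :: "('a, 'm) chart \<Rightarrow> complex \<Rightarrow> complex^'m" where
  "vel c = vderiv (\<lambda>s. snd c (g s))"

lemma coords_has_derivative:
  assumes "c \<in> charts_at A (g \<zeta>)"
  shows "((\<lambda>s. snd c (g s)) has_derivative (\<lambda>h. h *s vel c \<zeta>)) (at \<zeta>)"
proof -
  have mem: "c \<in> A" "\<zeta> \<in> g -` fst c" using assms by (auto simp: charts_at_def)
  show ?thesis
    unfolding vel_def
    by (rule vderiv_has_derivative [where F = "\<lambda>s. snd c (g s)" and W = "g -` fst c"])
       (rule holomorphic open_vimage_chart mem)+
qed

lemma vel_holomorphic:
  assumes "c \<in> A"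
  shows "(\<lambda>s. vel c s $ i) holomorphic_on g -` fst c"
  unfolding vel_def
  by (rule vderiv_holomorphic [where F = "\<lambda>s. snd c (g s)" and W = "g -` fst c"])
     (rule holomorphic open_vimage_chart assms)+

definition tangent :: "complex \<Rightarrow> ('a, 'm) tvec" where
  "tangent \<zeta> = (\<lambda>c. if c \<in> charts_at A (g \<zeta>) then vel c \<zeta> else 0)"

text \<open>By the chain rule the velocities in different charts form one tangent vector, so its
  metric value may be computed in any chart around the point.\<close>

lemma tangent_eq:
  assumes c: "c \<in> charts_at A (g \<zeta>)"
  shows "tangent \<zeta> = tvec_of_coords A c (snd c (g \<zeta>)) (vel c \<zeta>)"
proof -
  have "vel d \<zeta> = dtrans c d (g \<zeta>) (vel c \<zeta>)" if d: "d \<in> charts_at A (g \<zeta>)" for d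
  proof -
    have mem: "c \<in> A" "d \<in> A" "g \<zeta> \<in> fst c" "g \<zeta> \<in> fst d" using c d by (auto simp: charts_at_def)
    have "((\<lambda>s. transition c d (snd c (g s))) has_derivative (\<lambda>h. dtrans c d (g \<zeta>) (h *s vel c \<zeta>))) (at \<zeta>)"
      by (rule has_derivative_compose [OF coords_has_derivative [OF c] transition_has_derivative [OF c d]])
    then have "((\<lambda>s. transition c d (snd c (g s))) has_derivative (\<lambda>h. h *s dtrans c d (g \<zeta>) (vel c \<zeta>))) (at \<zeta>)"
      by (simp only: dtrans_smult [OF c d])
    then have "((\<lambda>s. snd d (g s)) has_derivative (\<lambda>h. h *s dtrans c d (g \<zeta>) (vel c \<zeta>))) (at \<zeta>)"
      by (rule has_derivative_transform_within_open [OF _ open_vimage_chart [OF mem(1)]])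
         (use mem in \<open>auto simp: transition_apply\<close>)
    then show ?thesis unfolding vel_def by (rule vderiv_unique)
  qed
  then show ?thesis by (auto simp: tangent_def tvec_of_coords_apply [OF c])
qed

lemma ex_chart_at: obtains c where "c \<in> charts_at A (g \<zeta>)"
proof -
  have "g \<zeta> \<in> topspace X" using continuous by (auto simp: continuous_map_def)
  then show thesis using charts_cover that by (auto simp: charts_at_def)
qed

lemma H_tangent_coords:
  assumes "c \<in> charts_at A (g \<zeta>)"
  shows "H (g \<zeta>) (tangent \<zeta>) = in_coords A H c (snd c (g \<zeta>), vel c \<zeta>)"
  by (simp add: tangent_eq [OF assms] in_coords_apply [OF assms])

lemma coords_continuous_on: "c \<in> A \<Longrightarrow> continuous_on (g -` fst c) (\<lambda>s. snd c (g s))"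
  by (rule has_derivative_continuous_on, rule has_derivative_at_withinI, rule coords_has_derivative)
     (auto simp: charts_at_def)

lemma vel_continuous_on:
  assumes "c \<in> A"
  shows "continuous_on (g -` fst c) (vel c)"
proof -
  have "continuous_on (g -` fst c) (\<lambda>s. \<chi> i. vel c s $ i)"
    by (intro continuous_on_vec_lambda holomorphic_on_imp_continuous_on vel_holomorphic assms)
  then show ?thesis by simp
qed

text \<open>Zero velocity makes the coordinates constant on a ball, chart injectivity makes
  \<open>g\<close> constant there, and connectedness of the plane makes this global.\<close>

lemma constant_if_vel_zero:
  assumes "\<And>c \<zeta>. c \<in> charts_at A (g \<zeta>) \<Longrightarrow> vel c \<zeta> = 0"
  shows "g \<zeta> = g \<xi>"
proof -
  have "g constant_on UNIV"
  proof (rule locally_constant_imp_constant [OF connected_UNIV])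
    fix a :: complex
    obtain c where c: "c \<in> charts_at A (g a)" by (rule ex_chart_at)
    then have mem: "c \<in> A" "a \<in> g -` fst c" by (auto simp: charts_at_def)
    then obtain d where d: "d > 0" "ball a d \<subseteq> g -` fst c"
      using open_vimage_chart open_contains_ball by blast
    have at: "c \<in> charts_at A (g x)" if "x \<in> ball a d" for x
      using that d mem by (auto simp: charts_at_def)
    have "((\<lambda>s. snd c (g s)) has_derivative (\<lambda>h. 0)) (at x within ball a d)" if "x \<in> ball a d" for x
      using coords_has_derivative [OF at [OF that]] assms [OF at [OF that]] has_derivative_at_withinI by auto
    then obtain k where "\<And>x. x \<in> ball a d \<Longrightarrow> snd c (g x) = k"
      using has_derivative_zero_constant [of "ball a d" "\<lambda>s. snd c (g s)"] by auto
    then have k: "snd c (g x) = snd c (g a)" if "x \<in> ball a d" for x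
      using that d(1) by simp
    have eq: "\<forall>x\<in>ball a d. g x = g a"
    proof
      fix x assume x: "x \<in> ball a d"
      show "g x = g a"
        by (rule inj_onD [OF chart_inj_on [OF mem(1)] k [OF x]]) (use x d mem in auto)
    qed
    have "openin (top_of_set UNIV) (ball a d)" "a \<in> ball a d" using d(1) by simp_all
    with eq show "\<exists>T. openin (top_of_set UNIV) T \<and> a \<in> T \<and> (\<forall>x\<in>T. g x = g a)" by blast
  qed
  then obtain k where "\<forall>x\<in>UNIV. g x = k" unfolding constant_on_def ..
  then show ?thesis by simp
qed

lemma constant_if_negative_curvature:
  assumes H: "complex_finsler X A H" "strongly_pseudoconvex A H"
    and K: "K < 0" "hol_sect_curv_le X A H K"
  shows "g \<zeta> = g \<xi>"
proof (rule constant_if_vel_zero)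
  fix c \<zeta> assume c: "c \<in> charts_at A (g \<zeta>)"
  \<comment> \<open>No chart is chosen here, so the local estimates below, each in its own chart,
    concern one and the same function.\<close>
  define u where "u s = H (g s) (tangent s)" for s
  have coords: "finsler_coords (in_coords A H c) (chart_image c)" if "c \<in> A" for c
    by (rule finsler_coords_in_coords [OF H that])
  have tan: "tangent s \<in> hol_tangent A (g s)" "g s \<in> topspace X" for s
  proof -
    obtain c where "c \<in> charts_at A (g s)" by (rule ex_chart_at)
    then show "tangent s \<in> hol_tangent A (g s)"
      using tvec_of_coords_in_hol_tangent tangent_eq by metis
    show "g s \<in> topspace X" using continuous by (auto simp: continuous_map_def)
  qed
  have "u \<zeta> = 0"
  proof (rule Ahlfors_Schwarz_plane)
    show "0 \<le> u s" for s using H(1) tan unfolding complex_finsler_def u_def by blast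
    show "0 < - 2 * K" using K by simp
    show "continuous_on UNIV u"
    proof (rule continuous_at_imp_continuous_on, rule ballI)
      fix s :: complex
      obtain c where c: "c \<in> charts_at A (g s)" by (rule ex_chart_at)
      then have mem: "c \<in> A" "s \<in> g -` fst c" by (auto simp: charts_at_def)
      have "continuous_on (chart_image c \<times> UNIV) (in_coords A H c)"
        using H(1) mem by (simp add: complex_finsler_def)
      then have "continuous_on (g -` fst c) (\<lambda>s. in_coords A H c (snd c (g s), vel c s))"
        by (rule continuous_on_compose2)
           (auto intro!: continuous_on_Pair coords_continuous_on vel_continuous_on mem chart_in_image)
      then have "continuous_on (g -` fst c) u"
        by (rule continuous_on_eq) (use mem in \<open>auto simp: u_def H_tangent_coords charts_at_def\<close>)
      then show "isCont u s"
        using continuous_on_eq_continuous_at open_vimage_chart mem by blast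
    qed
    show "log_laplacian_ge (- 2 * K) u s" if us: "0 < u s" for s
    proof -
      obtain c where c: "c \<in> charts_at A (g s)" by (rule ex_chart_at)
      then have mem: "c \<in> A" "s \<in> g -` fst c" by (auto simp: charts_at_def)
      interpret F: finsler_coords "in_coords A H c" "chart_image c" by (rule coords [OF mem(1)])
      have at: "c \<in> charts_at A (g t)" if "t \<in> g -` fst c" for t
        using that mem by (auto simp: charts_at_def)
      \<comment> \<open>Homogeneity with factor 0 shows that the metric vanishes on the zero vector,
        which \<open>us\<close> excludes.\<close>
      have vs: "vel c s \<noteq> 0"
      proof
        assume "vel c s = 0"
        then have "u s = in_coords A H c (snd c (g s), 0 *s vel c s)"
          by (simp add: u_def H_tangent_coords [OF c])
        also have "\<dots> = 0" using F.homogeneous [of "snd c (g s)" 0 "vel c s"] mem chart_in_image [of "g s" c] by simp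
        finally show False using us by simp
      qed
      \<comment> \<open>On \<open>W\<close> the lifted curve avoids the zero section, so the metric
        is smooth along it.\<close>
      define W where "W = {t \<in> g -` fst c. vel c t \<noteq> 0}"
      have W: "open W"
      proof -
        have "W = g -` fst c \<inter> vel c -` (- {0})" by (auto simp: W_def)
        moreover have "open (- {0 :: complex^'m})" by auto
        ultimately show ?thesis
          using continuous_open_preimage [OF vel_continuous_on open_vimage_chart, OF mem(1) mem(1), of "- {0}"] by simp
      qed
      have WS: "(snd c (g t), vel c t) \<in> F.S" if "t \<in> W" for t
        using that by (auto simp: W_def F.S_def chart_in_image)
      show ?thesis
      proof (rule F.curve_log_laplacian [OF W, where \<phi> = "\<lambda>t. (snd c (g t), vel c t)"
            and \<psi> = "\<lambda>t. (vel c t, vderiv (vel c) t)"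
            and \<theta> = "\<lambda>t. (vderiv (vel c) t, vderiv (vderiv (vel c)) t)"])
        show "s \<in> W" using vs mem by (simp add: W_def)
        fix t assume t: "t \<in> W"
        then have t': "t \<in> g -` fst c" by (simp add: W_def)
        show "(snd c (g t), vel c t) \<in> F.S" by (rule WS [OF t])
        show "u t = in_coords A H c (snd c (g t), vel c t)"
          by (simp add: u_def H_tangent_coords [OF at [OF t']])
        have 1: "(vel c has_derivative (\<lambda>h. h *s vderiv (vel c) t)) (at t)"
          by (rule vderiv_has_derivative [OF vel_holomorphic [OF mem(1)] open_vimage_chart [OF mem(1)] t'])
        have 2: "(vderiv (vel c) has_derivative (\<lambda>h. h *s vderiv (vderiv (vel c)) t)) (at t)"
          by (rule vderiv_has_derivative [OF vderiv_holomorphic [OF vel_holomorphic [OF mem(1)] open_vimage_chart [OF mem(1)]]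
                open_vimage_chart [OF mem(1)] t'])
        show "((\<lambda>t. (snd c (g t), vel c t)) has_derivative (\<lambda>h. cscale h (vel c t, vderiv (vel c) t))) (at t)"
          using has_derivative_Pair [OF coords_has_derivative [OF at [OF t']] 1] by simp
        show "((\<lambda>t. (vel c t, vderiv (vel c) t)) has_derivative
            (\<lambda>h. cscale h (vderiv (vel c) t, vderiv (vderiv (vel c)) t))) (at t)"
          using has_derivative_Pair [OF 1 2] by simp
      next
        have "tangent s c = vel c s" using c by (simp add: tangent_def)
        moreover from this vs have "tangent s \<noteq> (\<lambda>_. 0)" by auto
        ultimately have "hol_sect_curv A H c (g s) (tangent s) \<le> K"
          using K(2) tan c unfolding hol_sect_curv_le_def by blast
        then show "hsc_coords (in_coords A H c) (snd c (g s), vel c s) \<le> K"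
          using c by (simp add: hol_sect_curv_def tangent_def)
      qed simp
    qed
  qed
  then have "in_coords A H c (snd c (g \<zeta>), vel c \<zeta>) = 0"
    by (simp add: u_def H_tangent_coords [OF c])
  moreover have mem: "c \<in> A" "g \<zeta> \<in> fst c" using c by (auto simp: charts_at_def)
  interpret F: finsler_coords "in_coords A H c" "chart_image c" by (rule coords [OF mem(1)])
  have "0 < in_coords A H c (snd c (g \<zeta>), vel c \<zeta>)" if "vel c \<zeta> \<noteq> 0"
    by (rule F.L_pos) (use that mem in \<open>auto simp: F.S_def chart_in_image\<close>)
  ultimately show "vel c \<zeta> = 0" by force
qed

end

lemma holomorphic_curve_line:
  fixes f :: "complex^'n \<Rightarrow> 'a"
  assumes "complex_manifold X A" and f: "hol_map_into X A f"
  shows "holomorphic_curve X A (\<lambda>\<zeta>. f (a + \<zeta> *s b))"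
proof -
  interpret complex_manifold X A by fact
  have line: "((\<lambda>\<zeta>. a + \<zeta> *s b) has_derivative (\<lambda>h. h *s b)) (at \<zeta>)" for \<zeta>
  proof -
    have "((\<lambda>\<zeta>. \<zeta> *s b) has_derivative (\<lambda>h. h *s b)) (at \<zeta>)"
      by (rule linear_imp_has_derivative, rule linearI) (simp_all add: vec_eq_iff algebra_simps)
    then show ?thesis by (auto intro!: derivative_eq_intros)
  qed
  show ?thesis
  proof
    have "continuous_on UNIV (\<lambda>\<zeta>. a + \<zeta> *s b)"
      by (rule has_derivative_continuous_on, rule has_derivative_at_withinI, rule line)
    then have "continuous_map euclidean euclidean (\<lambda>\<zeta>. a + \<zeta> *s b)" by simp
    from continuous_map_compose [OF this, of X f] f
    show "continuous_map euclidean X (\<lambda>\<zeta>. f (a + \<zeta> *s b))" by (simp add: hol_map_into_def o_def)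
    fix c i assume c: "c \<in> A"
    show "(\<lambda>s. snd c (f (a + s *s b)) $ i) holomorphic_on (\<lambda>\<zeta>. f (a + \<zeta> *s b)) -` fst c"
      unfolding holomorphic_on_def
    proof (intro ballI)
      fix \<zeta> assume "\<zeta> \<in> (\<lambda>\<zeta>. f (a + \<zeta> *s b)) -` fst c"
      then have "a + \<zeta> *s b \<in> f -` fst c" by simp
      moreover have "hol_on (snd c \<circ> f) (f -` fst c)" using f c by (simp add: hol_map_into_def)
      ultimately obtain D where D: "((snd c \<circ> f) has_derivative D) (at (a + \<zeta> *s b))" "\<And>k v. D (k *s v) = k *s D v"
        unfolding hol_on_def by blast
      have "((\<lambda>s. (snd c \<circ> f) (a + s *s b) $ i) has_derivative (\<lambda>h. D (h *s b) $ i)) (at \<zeta>)"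
        by (rule bounded_linear.has_derivative [OF bounded_linear_vec_nth has_derivative_compose [OF line D(1)]])
      \<comment> \<open>Complex linearity of \<open>D\<close> turns the real differential along the
        line into multiplication by a complex number.\<close>
      then have "((\<lambda>s. snd c (f (a + s *s b)) $ i) has_field_derivative D b $ i) (at \<zeta>)"
        by (simp add: has_field_derivative_def D(2) mult_commute_abs)
      then show "(\<lambda>s. snd c (f (a + s *s b)) $ i) field_differentiable at \<zeta> within (\<lambda>\<zeta>. f (a + \<zeta> *s b)) -` fst c"
        using field_differentiable_def field_differentiable_at_within by blast
    qed
  qed
qed

theorem corollary7p2:
  fixes G :: "complex^'n \<Rightarrow> complex^'n \<Rightarrow> real"
    and X :: "'a topology" and A :: "('a, 'm::finite) chart set"
    and H :: "'a \<Rightarrow> ('a, 'm) tvec \<Rightarrow> real"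
    and K2 :: real and f :: "complex^'n \<Rightarrow> 'a"
  assumes "complex_minkowski G"
    and "complex_manifold X A"
    and "complex_finsler X A H"
    and "strongly_pseudoconvex A H"
    and "K2 < 0"
    and "hol_sect_curv_le X A H K2"
    and "hol_map_into X A f"
  shows "f constant_on UNIV"
proof -
  have "f a = f 0" for a
  proof -
    \<comment> \<open>The complex line through 0 and \<open>a\<close>; its parameters 1 and 0 give
      the two points to be compared.\<close>
    interpret holomorphic_curve X A "\<lambda>\<zeta>. f (0 + \<zeta> *s a)"
      by (rule holomorphic_curve_line [OF assms(2,7)])
    show ?thesis
      using constant_if_negative_curvature [OF assms(3-6), of 1 0] by simp
  qed
  then show ?thesis unfolding constant_on_def by blast
qed

end
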